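(* Let $n\in\mathbb{N}\setminus\{0,1\}$ and let $t_1,t_2,T$ be real numbers with $0<t_1<t_2<T$. Let $u\in L^2((0,T)\times(-n,n))$ satisfy $Pu=0$ in $(0,T)\times(-n,n)$ and $\operatorname{supp} u\subset[t_1,t_2]\times(-n,n)$. Let $0<\epsilon<\min(t_1,T-t_2)$. Then there exists $v\in L^2((0,T)\times(-n-1,n+1))$ such that $Pv=0$ in $(0,T)\times(-n-1,n+1)$, $\operatorname{supp} v\subset[t_1-\epsilon,t_2+\epsilon]\times(-n-1,n+1)$, and $$\|v-u\|_{L^2((0,T)\times(-n+1,n-1))}<\epsilon.$$
   Context: $P=\partial_t+\partial_x+\partial_x^3-\partial_x^5$ is the linear Kawahara operator; equations $Pu=0$ on an open set are understood in the sense of distributions on that set. *)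

theory Defs
  imports "HOL-Analysis.Analysis"
begin

definition strip :: "real \<Rightarrow> real \<Rightarrow> (real \<times> real) set" where
  "strip T a = {p. 0 < fst p \<and> fst p < T \<and> - a < snd p \<and> snd p < a}"

text \<open>D i j is the mixed partial derivative d_t^i d_x^j of D 0 0; all exist
  everywhere and are continuous, i.e. D 0 0 is C-infinity.\<close>
definition smooth_family :: "(nat \<Rightarrow> nat \<Rightarrow> real \<times> real \<Rightarrow> real) \<Rightarrow> bool" where
  "smooth_family D \<longleftrightarrow>
     (\<forall>i j. continuous_on UNIV (D i j) \<and>
        (\<forall>t x. ((\<lambda>s. D i j (s, x)) has_real_derivative D (Suc i) j (t, x)) (at t) \<and>
               ((\<lambda>y. D i j (t, y)) has_real_derivative D i (Suc j) (t, x)) (at x)))"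

definition test_fun :: "(real \<times> real) set \<Rightarrow> (nat \<Rightarrow> nat \<Rightarrow> real \<times> real \<Rightarrow> real) \<Rightarrow> bool" where
  "test_fun \<Omega> D \<longleftrightarrow> smooth_family D \<and>
     compact (closure {p. D 0 0 p \<noteq> 0}) \<and> closure {p. D 0 0 p \<noteq> 0} \<subseteq> \<Omega>"

definition L2_on :: "(real \<times> real) set \<Rightarrow> (real \<times> real \<Rightarrow> real) \<Rightarrow> bool" where
  "L2_on \<Omega> u \<longleftrightarrow> u \<in> borel_measurable (lebesgue_on \<Omega>) \<and>
     set_integrable lebesgue \<Omega> (\<lambda>p. (u p)\<^sup>2)"

definition L2_norm_on :: "(real \<times> real) set \<Rightarrow> (real \<times> real \<Rightarrow> real) \<Rightarrow> real" where
  "L2_norm_on \<Omega> u = sqrt (set_lebesgue_integral lebesgue \<Omega> (\<lambda>p. (u p)\<^sup>2))"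

text \<open>P u = 0 in the sense of distributions on Omega, where
  P = d_t + d_x + d_x^3 - d_x^5; the formal adjoint is
  -d_t - d_x - d_x^3 + d_x^5.\<close>
definition kawahara_sol :: "(real \<times> real) set \<Rightarrow> (real \<times> real \<Rightarrow> real) \<Rightarrow> bool" where
  "kawahara_sol \<Omega> u \<longleftrightarrow>
     (\<forall>D. test_fun \<Omega> D \<longrightarrow>
        set_lebesgue_integral lebesgue \<Omega>
          (\<lambda>p. u p * (- D 1 0 p - D 0 1 p - D 0 3 p + D 0 5 p)) = 0)"

definition supp_in :: "(real \<times> real) set \<Rightarrow> (real \<times> real \<Rightarrow> real) \<Rightarrow> (real \<times> real) set \<Rightarrow> bool" where
  "supp_in \<Omega> u S \<longleftrightarrow> (AE p in lebesgue_on \<Omega>. p \<notin> S \<longrightarrow> u p = 0)"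

end

theory Submission
  imports Defs "HOL-Complex_Analysis.Cauchy_Integral_Formula"
begin

text \<open>
  Mollify \<open>u\<close> in both variables with a compactly supported kernel that is Gevrey of order 2.  The
  result \<open>w\<close> is a classical solution on a slightly narrower strip, its time support grows only by
  the width of the kernel, and \<open>\<partial>\<^sub>t\<^sup>k w\<close> is bounded by \<open>C R\<^sup>k (k!)\<^sup>2\<close>.  Reading the equation as
  \<open>\<partial>\<^sub>x\<^sup>5 w = \<partial>\<^sub>t w + \<partial>\<^sub>x w + \<partial>\<^sub>x\<^sup>3 w\<close>, five \<open>x\<close>-derivatives cost one \<open>t\<close>-derivative, so \<open>\<partial>\<^sub>x\<^sup>j w\<close>
  is bounded by \<open>C R\<^sup>j ((j div 5)!)\<^sup>2\<close>.  Hence \<open>w\<close> is entire in \<open>x\<close>, and its Taylor series at \<open>x = 0\<close>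
  extends it to a classical solution \<open>v\<close> on all of the plane with the same time support.  As the width
  of the kernel tends to 0, \<open>w\<close> tends to \<open>u\<close> in \<open>L\<^sup>2\<close>, because translations are continuous in \<open>L\<^sup>2\<close>.
\<close>

section \<open>Directional derivatives\<close>

definition has_directional_derivative ::
    "'a::real_normed_vector \<Rightarrow> ('a \<Rightarrow> real) \<Rightarrow> ('a \<Rightarrow> real) \<Rightarrow> bool" where
  "has_directional_derivative v g g' \<longleftrightarrow>
     (\<forall>p. ((\<lambda>s. g (p + s *\<^sub>R v)) has_real_derivative g' p) (at 0))"

lemma has_directional_derivative_at:
  assumes "has_directional_derivative v g g'"
  shows "((\<lambda>s. g (p + s *\<^sub>R v)) has_real_derivative g' (p + t *\<^sub>R v)) (at t)"
proof -
  have "((\<lambda>s. g (p + t *\<^sub>R v + s *\<^sub>R v)) has_real_derivative g' (p + t *\<^sub>R v)) (at 0)"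
    using assms unfolding has_directional_derivative_def by blast
  then show ?thesis
    using DERIV_shift[of "\<lambda>s. g (p + s *\<^sub>R v)" "g' (p + t *\<^sub>R v)" 0 t]
    by (simp add: scaleR_add_left add.commute[of "_ *\<^sub>R v" "t *\<^sub>R v"] add.assoc)
qed

lemma has_directional_derivative_mult:
  assumes "has_directional_derivative v g g'" "has_directional_derivative v h h'"
  shows "has_directional_derivative v (\<lambda>p. g p * h p) (\<lambda>p. g p * h' p + g' p * h p)"
  using assms unfolding has_directional_derivative_def
  by (auto intro!: derivative_eq_intros)

lemma has_directional_derivative_cmult:
  assumes "has_directional_derivative v g g'"
  shows "has_directional_derivative v (\<lambda>p. c * g p) (\<lambda>p. c * g' p)"
  using assms unfolding has_directional_derivative_def by (auto intro: DERIV_cmult)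

lemma has_directional_derivative_reflect:
  assumes "has_directional_derivative v g g'"
  shows "has_directional_derivative v (\<lambda>p. g (z - p)) (\<lambda>p. - g' (z - p))"
  unfolding has_directional_derivative_def
proof
  fix p
  have "((\<lambda>s. g (z - p + s *\<^sub>R v)) has_real_derivative g' (z - p)) (at (- 0))"
    using assms by (simp add: has_directional_derivative_def)
  then have "((\<lambda>s. g (z - p + (- s) *\<^sub>R v)) has_real_derivative - g' (z - p)) (at 0)"
    by (subst (asm) DERIV_mirror)
  then show "((\<lambda>s. g (z - (p + s *\<^sub>R v))) has_real_derivative - g' (z - p)) (at 0)"
    by (simp add: diff_diff_add)
qed

lemma directional_derivative_eq_0_on_open:
  assumes "has_directional_derivative v g g'" and U: "open U" "\<And>p. p \<in> U \<Longrightarrow> g p = 0" and "p \<in> U"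
  shows "g' p = 0"
proof -
  have "((\<lambda>s. 0) has_real_derivative g' p) (at 0)"
  proof (rule has_field_derivative_transform_within_open)
    show "((\<lambda>s. g (p + s *\<^sub>R v)) has_real_derivative g' p) (at 0)"
      using assms(1) by (simp add: has_directional_derivative_def)
    show "open ((\<lambda>s. p + s *\<^sub>R v) -` U)"
      by (rule open_vimage[OF U(1)]) (intro continuous_intros)
  qed (use \<open>p \<in> U\<close> U(2) in simp_all)
  then show ?thesis
    by (rule DERIV_unique[OF _ DERIV_const])
qed

lemma has_real_derivative_integral:
  fixes g g' :: "real \<Rightarrow> 'a \<Rightarrow> real"
  assumes r_pos: "0 < r" and g_integrable: "\<And>s. integrable M (g s)"
    and g'_measurable: "g' t \<in> borel_measurable M"
    and deriv: "\<And>s p. ((\<lambda>s. g s p) has_real_derivative g' s p) (at s)"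
    and dominated: "integrable M w" "\<And>s p. s \<in> ball t r \<Longrightarrow> \<bar>g' s p\<bar> \<le> w p"
  shows "((\<lambda>s. \<integral>p. g s p \<partial>M) has_real_derivative (\<integral>p. g' t p \<partial>M)) (at t)"
proof -
  have quotient_le: "\<bar>(g s p - g t p) / (s - t)\<bar> \<le> w p" if s_near: "s \<in> ball t r - {t}" for s p
  proof -
    have "norm (g s p - g t p) \<le> w p * norm (s - t)"
    proof (rule field_differentiable_bound[OF convex_ball])
      show "((\<lambda>s. g s p) has_field_derivative g' s p) (at s within ball t r)" for s
        by (rule has_field_derivative_at_within[OF deriv])
    qed (use s_near r_pos dominated(2) in auto)
    then show ?thesis
      using s_near by (simp add: divide_simps)
  qed
  have "((\<lambda>s. ((\<integral>p. g s p \<partial>M) - (\<integral>p. g t p \<partial>M)) / (s - t)) \<longlongrightarrow> (\<integral>p. g' t p \<partial>M))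
      (at t within ball t r)"
    unfolding tendsto_at_iff_sequentially comp_def
  proof (intro allI impI)
    fix X assume X_near: "\<forall>i. X i \<in> ball t r - {t}" "X \<longlonglongrightarrow> t"
    have "(\<lambda>i. \<integral>p. (g (X i) p - g t p) / (X i - t) \<partial>M) \<longlonglongrightarrow> (\<integral>p. g' t p \<partial>M)"
    proof (rule integral_dominated_convergence[OF g'_measurable _ dominated(1)])
      show "(\<lambda>p. (g (X i) p - g t p) / (X i - t)) \<in> borel_measurable M" for i
        using g_integrable by (intro borel_measurable_divide borel_measurable_diff) auto
      have "(\<lambda>i. (g (X i) p - g t p) / (X i - t)) \<longlonglongrightarrow> g' t p" for p
        using deriv[of p t] X_near
        unfolding has_field_derivative_iff tendsto_at_iff_sequentially comp_def
        by auto
      then show "AE p in M. (\<lambda>i. (g (X i) p - g t p) / (X i - t)) \<longlonglongrightarrow> g' t p"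
        by simp
      show "AE p in M. norm ((g (X i) p - g t p) / (X i - t)) \<le> w p" for i
        using quotient_le X_near(1) by simp
    qed
    then show "(\<lambda>i. ((\<integral>p. g (X i) p \<partial>M) - (\<integral>p. g t p \<partial>M)) / (X i - t)) \<longlonglongrightarrow> (\<integral>p. g' t p \<partial>M)"
      using g_integrable by simp
  qed
  then show ?thesis
    using r_pos by (simp add: has_field_derivative_iff at_within_open[of t "ball t r"])
qed

lemma integrable_continuous_compact_support:
  fixes h :: "'a::euclidean_space \<Rightarrow> real"
  assumes "continuous_on UNIV h" "compact S" "\<And>p. p \<notin> S \<Longrightarrow> h p = 0"
  shows "integrable lborel h"
proof -
  have "integrable lborel (\<lambda>p. indicator S p *\<^sub>R h p)"
    using assms by (intro borel_integrable_compact continuous_on_subset[OF assms(1)]) auto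
  moreover have "(\<lambda>p. indicator S p *\<^sub>R h p) = h"
    using assms(3) by (auto simp: fun_eq_iff indicator_def)
  ultimately show ?thesis by metis
qed

lemma bounded_range_continuous_compact_support:
  fixes h :: "'a::topological_space \<Rightarrow> real"
  assumes "continuous_on UNIV h" "compact S" "\<And>p. p \<notin> S \<Longrightarrow> h p = 0"
  shows "bounded (range h)"
proof (rule bounded_subset)
  show "bounded (insert 0 (h ` S))"
    using assms by (intro bounded_insert[THEN iffD2] compact_imp_bounded compact_continuous_image
        continuous_on_subset[OF assms(1)]) auto
  show "range h \<subseteq> insert 0 (h ` S)"
    using assms(3) by auto
qed

lemma has_bochner_integral_lborel_translate:
  fixes f :: "'a::euclidean_space \<Rightarrow> 'b::{banach, second_countable_topology}"
  assumes "has_bochner_integral lborel f x"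
  shows "has_bochner_integral lborel (\<lambda>p. f (p + c)) x"
proof -
  have [measurable]: "f \<in> borel_measurable borel"
    using borel_measurable_has_bochner_integral[OF assms] by simp
  have "has_bochner_integral (distr lborel borel ((+) c)) f x"
    using assms by (simp add: lborel_distr_plus)
  then show ?thesis
    by (simp add: has_bochner_integral_iff integrable_distr_eq integral_distr add.commute)
qed

text \<open>The integral of \<open>g (p + s *\<^sub>R v)\<close> over \<open>p\<close> does not depend on \<open>s\<close>; differentiate it at
  \<open>s = 0\<close>.\<close>

lemma integral_directional_derivative_eq_0:
  fixes g g' :: "'a::euclidean_space \<Rightarrow> real"
  assumes deriv: "has_directional_derivative v g g'"
    and cont: "continuous_on UNIV g" "continuous_on UNIV g'"
    and supp: "compact S" "\<And>p. p \<notin> S \<Longrightarrow> g p = 0" "\<And>p. p \<notin> S \<Longrightarrow> g' p = 0"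
  shows "(\<integral>p. g' p \<partial>lborel) = 0"
proof -
  obtain K where norm_S_le: "\<And>p. p \<in> S \<Longrightarrow> norm p \<le> K"
    using compact_imp_bounded[OF supp(1)] by (auto simp: bounded_iff)
  obtain B where g'_bound: "\<And>p. \<bar>g' p\<bar> \<le> B"
    using bounded_range_continuous_compact_support[OF cont(2) supp(1,3)] by (auto simp: bounded_iff)
  define w where "w p = B * indicator (cball 0 (K + norm v)) p" for p :: 'a
  have dominated: "\<bar>g' (p + s *\<^sub>R v)\<bar> \<le> w p" if "s \<in> ball 0 1" for s p
  proof (cases "p \<in> cball 0 (K + norm v)")
    case False
    have "norm (s *\<^sub>R v) \<le> norm v"
      using that by (simp add: mult_left_le_one_le)
    then have "p + s *\<^sub>R v \<notin> S"
      using False norm_S_le norm_diff_ineq[of p "s *\<^sub>R v"] by force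
    then show ?thesis
      using False by (simp add: supp w_def)
  qed (simp add: w_def g'_bound)
  have translate: "has_bochner_integral lborel (\<lambda>p. g (p + s *\<^sub>R v)) (\<integral>p. g p \<partial>lborel)" for s
    by (rule has_bochner_integral_lborel_translate[OF has_bochner_integral_integrable])
       (rule integrable_continuous_compact_support[OF cont(1) supp(1,2)])
  have "((\<lambda>s. \<integral>p. g (p + s *\<^sub>R v) \<partial>lborel)
      has_real_derivative (\<integral>p. g' (p + 0 *\<^sub>R v) \<partial>lborel)) (at 0)"
  proof (rule has_real_derivative_integral[where w = w and r = 1])
    show "integrable lborel (\<lambda>p. g (p + s *\<^sub>R v))" for s
      using translate by (rule integrable.intros)
    show "(\<lambda>p. g' (p + 0 *\<^sub>R v)) \<in> borel_measurable lborel"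
      using borel_measurable_continuous_onI[OF cont(2)] by simp
    show "integrable lborel w"
      unfolding w_def
      by (intro integrable_mult_right integrable_real_indicator emeasure_lborel_cball_finite) simp
  qed (simp_all add: dominated has_directional_derivative_at[OF deriv])
  then show ?thesis
    using DERIV_unique[OF _ DERIV_const]
    by (simp add: has_bochner_integral_integral_eq[OF translate])
qed

lemma integral_by_parts:
  fixes g h :: "'a::euclidean_space \<Rightarrow> real"
  assumes g: "has_directional_derivative v g g'" "continuous_on UNIV g" "continuous_on UNIV g'"
    and h: "has_directional_derivative v h h'" "continuous_on UNIV h" "continuous_on UNIV h'"
    and supp: "compact S" "\<And>p. p \<notin> S \<Longrightarrow> h p = 0" "\<And>p. p \<notin> S \<Longrightarrow> h' p = 0"
  shows "(\<integral>p. g p * h' p \<partial>lborel) = - (\<integral>p. g' p * h p \<partial>lborel)"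
proof -
  have "integrable lborel (\<lambda>p. g p * h' p)" "integrable lborel (\<lambda>p. g' p * h p)"
    using supp
    by (auto intro!: integrable_continuous_compact_support[where S = S] continuous_intros g h)
  moreover have "(\<integral>p. g p * h' p + g' p * h p \<partial>lborel) = 0"
    by (rule integral_directional_derivative_eq_0[where S = S,
        OF has_directional_derivative_mult[OF g(1) h(1)]])
       (auto intro!: continuous_intros g h simp: supp)
  ultimately show ?thesis
    by simp
qed

section \<open>Smooth families\<close>

lemma has_directional_derivative_fst_iff:
  fixes g :: "real \<times> real \<Rightarrow> real"
  shows "has_directional_derivative (1, 0) g g' \<longleftrightarrow>
    (\<forall>t x. ((\<lambda>s. g (s, x)) has_real_derivative g' (t, x)) (at t))"
proof -
  have "((\<lambda>s. g (s, x)) has_real_derivative g' (t, x)) (at t)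
      \<longleftrightarrow> ((\<lambda>s. g (t + s, x)) has_real_derivative g' (t, x)) (at 0)" for t x
    using DERIV_shift[of "\<lambda>s. g (s, x)" "g' (t, x)" 0 t] by (simp add: add.commute)
  then show ?thesis
    by (simp add: has_directional_derivative_def)
qed

lemma has_directional_derivative_snd_iff:
  fixes g :: "real \<times> real \<Rightarrow> real"
  shows "has_directional_derivative (0, 1) g g' \<longleftrightarrow>
    (\<forall>t x. ((\<lambda>y. g (t, y)) has_real_derivative g' (t, x)) (at x))"
proof -
  have "((\<lambda>y. g (t, y)) has_real_derivative g' (t, x)) (at x)
      \<longleftrightarrow> ((\<lambda>y. g (t, x + y)) has_real_derivative g' (t, x)) (at 0)" for t x
    using DERIV_shift[of "\<lambda>y. g (t, y)" "g' (t, x)" 0 x] by (simp add: add.commute)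
  then show ?thesis
    by (simp add: has_directional_derivative_def)
qed

lemma smooth_family_iff:
  "smooth_family D \<longleftrightarrow> (\<forall>i j. continuous_on UNIV (D i j)
      \<and> has_directional_derivative (1, 0) (D i j) (D (Suc i) j)
      \<and> has_directional_derivative (0, 1) (D i j) (D i (Suc j)))"
  unfolding smooth_family_def has_directional_derivative_fst_iff has_directional_derivative_snd_iff
  by (simp only: all_conj_distrib)

lemma smooth_familyD:
  assumes "smooth_family D"
  shows "continuous_on A (D i j)"
    and "has_directional_derivative (1, 0) (D i j) (D (Suc i) j)"
    and "has_directional_derivative (0, 1) (D i j) (D i (Suc j))"
  using assms continuous_on_subset[of UNIV "D i j" A] by (auto simp: smooth_family_iff)

lemma borel_measurable_smooth_family:
  "smooth_family D \<Longrightarrow> D i j \<in> borel_measurable borel"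
  by (intro borel_measurable_continuous_onI smooth_familyD)

lemma smooth_family_eq_0_on_open:
  assumes D: "smooth_family D" and U: "open U" "\<And>p. p \<in> U \<Longrightarrow> D 0 0 p = 0"
  shows "p \<in> U \<Longrightarrow> D i j p = 0"
proof (induction j arbitrary: p)
  case 0
  then show ?case
  proof (induction i arbitrary: p)
    case (Suc i)
    then show ?case
      by (intro directional_derivative_eq_0_on_open[OF smooth_familyD(2)[OF D] U(1)])
  qed (rule U)
next
  case (Suc j)
  then show ?case
    by (intro directional_derivative_eq_0_on_open[OF smooth_familyD(3)[OF D] U(1)])
qed

lemma smooth_family_cmult:
  "smooth_family D \<Longrightarrow> smooth_family (\<lambda>i j p. c * D i j p)"
  unfolding smooth_family_iff
  by (simp add: continuous_on_mult_left has_directional_derivative_cmult)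

lemma smooth_family_reflect:
  assumes "smooth_family D"
  shows "smooth_family (\<lambda>a b p. (-1) ^ (a + b) * D (i + a) (j + b) (z - p))"
  unfolding smooth_family_iff
proof (intro allI conjI)
  fix a b
  let ?R = "\<lambda>a b p. (-1) ^ (a + b) * D (i + a) (j + b) (z - p)"
  show "continuous_on UNIV (?R a b)"
    by (intro continuous_intros continuous_on_compose2[OF smooth_familyD(1)[OF assms, of UNIV]]) auto
  show "has_directional_derivative (1, 0) (?R a b) (?R (Suc a) b)"
    using has_directional_derivative_cmult[OF has_directional_derivative_reflect,
        OF smooth_familyD(2)[OF assms], of "(-1) ^ (a + b)" "i + a" "j + b" z] by simp
  show "has_directional_derivative (0, 1) (?R a b) (?R a (Suc b))"
    using has_directional_derivative_cmult[OF has_directional_derivative_reflect,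
        OF smooth_familyD(3)[OF assms], of "(-1) ^ (a + b)" "i + a" "j + b" z] by simp
qed

lemma integral_smooth_family_by_parts:
  assumes V: "smooth_family V" and D: "smooth_family D"
    and supp: "compact S" "\<And>p. p \<notin> S \<Longrightarrow> D 0 0 p = 0"
  shows "(\<integral>p. V 0 0 p * D i j p \<partial>lborel) = (-1) ^ (i + j) * (\<integral>p. V i j p * D 0 0 p \<partial>lborel)"
proof -
  have outside: "D a b p = 0" if "p \<notin> S" for a b p
    by (rule smooth_family_eq_0_on_open[OF D, of "- S"])
       (use that supp in \<open>auto simp: open_Compl compact_imp_closed\<close>)
  have by_parts_t:
    "(\<integral>p. V a b p * D (Suc c) d p \<partial>lborel) = - (\<integral>p. V (Suc a) b p * D c d p \<partial>lborel)" for a b c d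
    by (rule integral_by_parts[OF smooth_familyD(2,1,1)[OF V] smooth_familyD(2,1,1)[OF D]
        supp(1) outside outside])
  have by_parts_x:
    "(\<integral>p. V a b p * D c (Suc d) p \<partial>lborel) = - (\<integral>p. V a (Suc b) p * D c d p \<partial>lborel)" for a b c d
    by (rule integral_by_parts[OF smooth_familyD(3,1,1)[OF V] smooth_familyD(3,1,1)[OF D]
        supp(1) outside outside])
  have "(\<integral>p. V 0 b p * D i j p \<partial>lborel) = (-1) ^ (i + j) * (\<integral>p. V i (b + j) p * D 0 0 p \<partial>lborel)"
    for b
  proof (induction j arbitrary: b)
    case 0
    have "(\<integral>p. V a b p * D i 0 p \<partial>lborel) = (-1) ^ i * (\<integral>p. V (a + i) b p * D 0 0 p \<partial>lborel)" for a
      by (induction i arbitrary: a) (simp_all add: by_parts_t)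
    from this[of 0] show ?case by simp
  qed (simp add: by_parts_x)
  from this[of 0] show ?thesis by simp
qed

section \<open>Convolution\<close>

definition convolve :: "('a::euclidean_space \<Rightarrow> real) \<Rightarrow> ('a \<Rightarrow> real) \<Rightarrow> 'a \<Rightarrow> real" where
  "convolve f k z = (\<integral>p. f p * k (z - p) \<partial>lborel)"

lemma integrable_convolve:
  fixes f k :: "'a::euclidean_space \<Rightarrow> real"
  assumes f: "integrable lborel f" and k: "k \<in> borel_measurable borel" "bounded (range k)"
  shows "integrable lborel (\<lambda>p. f p * k (z - p))"
proof -
  obtain B where k_bound: "\<And>p. \<bar>k p\<bar> \<le> B"
    using k(2) by (auto simp: bounded_iff)
  show ?thesis
  proof (rule Bochner_Integration.integrable_bound)
    show "integrable lborel (\<lambda>p. f p * B)" "(\<lambda>p. f p * k (z - p)) \<in> borel_measurable lborel"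
      using f k(1) by auto
    have "norm (f p * k (z - p)) \<le> norm (f p * B)" for p
      using order_trans[OF k_bound[of "z - p"] abs_ge_self] by (simp add: abs_mult mult_left_mono)
    then show "AE p in lborel. norm (f p * k (z - p)) \<le> norm (f p * B)"
      by (rule AE_I2)
  qed
qed

lemma abs_convolve_le:
  fixes f k :: "'a::euclidean_space \<Rightarrow> real"
  assumes f: "integrable lborel f" and k: "k \<in> borel_measurable borel" "\<And>p. \<bar>k p\<bar> \<le> B"
  shows "\<bar>convolve f k z\<bar> \<le> B * (\<integral>p. \<bar>f p\<bar> \<partial>lborel)"
proof -
  have "bounded (range k)"
    by (rule boundedI[of _ B]) (use k(2) in auto)
  then have "integrable lborel (\<lambda>p. f p * k (z - p))"
    by (rule integrable_convolve[OF f k(1)])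
  then have "(\<integral>p. \<bar>f p * k (z - p)\<bar> \<partial>lborel) \<le> (\<integral>p. \<bar>f p\<bar> * B \<partial>lborel)"
    by (rule integral_mono[OF integrable_abs]) (auto simp: f abs_mult k(2) intro!: mult_left_mono)
  also have "\<dots> = B * (\<integral>p. \<bar>f p\<bar> \<partial>lborel)"
    by simp
  finally show ?thesis
    unfolding convolve_def by (rule order_trans[OF integral_abs_bound])
qed

lemma convolve_eq_0: "(\<And>p. f p \<noteq> 0 \<Longrightarrow> k (z - p) = 0) \<Longrightarrow> convolve f k z = 0"
  unfolding convolve_def by (intro integral_eq_zero_AE AE_I2) auto

lemma continuous_on_convolve:
  fixes f k :: "'a::euclidean_space \<Rightarrow> real"
  assumes f: "integrable lborel f" and k: "continuous_on UNIV k" "bounded (range k)"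
  shows "continuous_on A (convolve f k)"
proof -
  obtain B where k_bound: "\<And>p. \<bar>k p\<bar> \<le> B"
    using k(2) by (auto simp: bounded_iff)
  have k_measurable: "k \<in> borel_measurable borel"
    by (rule borel_measurable_continuous_onI[OF k(1)])
  have "isCont (convolve f k) z" for z
    unfolding continuous_at_sequentially comp_def
  proof (intro allI impI)
    fix X assume X_lim: "X \<longlonglongrightarrow> z"
    show "(\<lambda>n. convolve f k (X n)) \<longlonglongrightarrow> convolve f k z"
      unfolding convolve_def
    proof (rule integral_dominated_convergence[where w = "\<lambda>p. \<bar>f p\<bar> * B"])
      have "(\<lambda>n. k (X n - p)) \<longlonglongrightarrow> k (z - p)" for p
        using k(1) by (intro continuous_on_tendsto_compose[OF k(1)] tendsto_intros X_lim) auto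
      then show "AE p in lborel. (\<lambda>n. f p * k (X n - p)) \<longlonglongrightarrow> f p * k (z - p)"
        by (intro AE_I2 tendsto_intros)
      show "AE p in lborel. norm (f p * k (X n - p)) \<le> \<bar>f p\<bar> * B" for n
        using k_bound by (intro AE_I2) (auto simp: abs_mult intro: mult_left_mono)
    qed (use f integrable_convolve[OF f k_measurable k(2)] in auto)
  qed
  then show ?thesis
    by (simp add: continuous_at_imp_continuous_on)
qed

lemma has_directional_derivative_convolve:
  fixes f k :: "'a::euclidean_space \<Rightarrow> real"
  assumes f: "integrable lborel f" and deriv: "has_directional_derivative v k k'"
    and k: "continuous_on UNIV k" "bounded (range k)"
    and k': "continuous_on UNIV k'" "bounded (range k')"
  shows "has_directional_derivative v (convolve f k) (convolve f k')"
  unfolding has_directional_derivative_def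
proof
  fix z
  obtain B where k'_bound: "\<And>p. \<bar>k' p\<bar> \<le> B"
    using k'(2) by (auto simp: bounded_iff)
  note measurable = borel_measurable_continuous_onI[OF k(1)]
    borel_measurable_continuous_onI[OF k'(1)]
  have "((\<lambda>s. \<integral>p. f p * k (z - p + s *\<^sub>R v) \<partial>lborel) has_real_derivative
      (\<integral>p. f p * k' (z - p + 0 *\<^sub>R v) \<partial>lborel)) (at 0)"
  proof (rule has_real_derivative_integral[where w = "\<lambda>p. \<bar>f p\<bar> * B" and r = 1])
    show "integrable lborel (\<lambda>p. f p * k (z - p + s *\<^sub>R v))" for s
      using integrable_convolve[OF f measurable(1) k(2), of "z + s *\<^sub>R v"]
      by (simp add: algebra_simps)
    show "(\<lambda>p. f p * k' (z - p + 0 *\<^sub>R v)) \<in> borel_measurable lborel"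
      using integrable_convolve[OF f measurable(2) k'(2), of z] by simp
    show "((\<lambda>s. f p * k (z - p + s *\<^sub>R v)) has_real_derivative f p * k' (z - p + s *\<^sub>R v)) (at s)"
      for s p
      by (intro DERIV_cmult has_directional_derivative_at deriv)
    show "\<bar>f p * k' (z - p + s *\<^sub>R v)\<bar> \<le> \<bar>f p\<bar> * B" for s p
      by (simp add: abs_mult mult_left_mono k'_bound)
  qed (use f in auto)
  then show "((\<lambda>s. convolve f k (z + s *\<^sub>R v)) has_real_derivative convolve f k' z) (at 0)"
    by (simp add: convolve_def algebra_simps)
qed

lemma smooth_family_convolve:
  assumes "integrable lborel f" "smooth_family K" "\<And>i j. bounded (range (K i j))"
  shows "smooth_family (\<lambda>i j. convolve f (K i j))"
  unfolding smooth_family_iff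
  using assms
  by (blast intro: continuous_on_convolve has_directional_derivative_convolve smooth_familyD)

section \<open>Mean-square distance\<close>

definition L2_sqdist :: "'a measure \<Rightarrow> ('a \<Rightarrow> real) \<Rightarrow> ('a \<Rightarrow> real) \<Rightarrow> ennreal" where
  "L2_sqdist M f g = (\<integral>\<^sup>+x. ennreal ((f x - g x)\<^sup>2) \<partial>M)"

lemma L2_sqdist_commute: "L2_sqdist M f g = L2_sqdist M g f"
  by (simp add: L2_sqdist_def power2_commute)

lemma L2_sqdist_triangle_le:
  assumes [measurable]: "f \<in> borel_measurable M" "g \<in> borel_measurable M" "h \<in> borel_measurable M"
    and fg: "L2_sqdist M f g \<le> ennreal a" and gh: "L2_sqdist M g h \<le> ennreal b" and "0 \<le> a" "0 \<le> b"
  shows "L2_sqdist M f h \<le> ennreal (2 * a + 2 * b)"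
proof -
  have "(f x - h x)\<^sup>2 \<le> 2 * (f x - g x)\<^sup>2 + 2 * (g x - h x)\<^sup>2" for x
    using zero_le_power2[of "f x - g x - (g x - h x)"] by (simp add: power2_eq_square algebra_simps)
  then have "ennreal ((f x - h x)\<^sup>2) \<le> ennreal (2 * (f x - g x)\<^sup>2 + 2 * (g x - h x)\<^sup>2)" for x
    by (rule ennreal_leI)
  then have "L2_sqdist M f h \<le> (\<integral>\<^sup>+x. 2 * ennreal ((f x - g x)\<^sup>2) + 2 * ennreal ((g x - h x)\<^sup>2) \<partial>M)"
    unfolding L2_sqdist_def by (intro nn_integral_mono) (simp add: ennreal_mult')
  also have "\<dots> = 2 * L2_sqdist M f g + 2 * L2_sqdist M g h"
    unfolding L2_sqdist_def by (simp add: nn_integral_cmult nn_integral_add)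
  also have "\<dots> \<le> 2 * ennreal a + 2 * ennreal b"
    by (intro add_mono mult_left_mono fg gh) auto
  also have "\<dots> = ennreal (2 * a + 2 * b)"
    using assms(6,7) by (simp add: ennreal_mult')
  finally show ?thesis .
qed

lemma L2_sqdist_tendsto_0:
  assumes [measurable]: "\<And>n. F n \<in> borel_measurable M" "f \<in> borel_measurable M"
    and lim: "AE x in M. (\<lambda>n. F n x) \<longlonglongrightarrow> f x"
    and dominated: "integrable M w" "\<And>n x. (F n x - f x)\<^sup>2 \<le> w x"
  shows "(\<lambda>n. L2_sqdist M (F n) f) \<longlonglongrightarrow> 0"
proof -
  have "(\<lambda>n. \<integral>\<^sup>+x. ennreal ((F n x - f x)\<^sup>2) \<partial>M) \<longlonglongrightarrow> (\<integral>\<^sup>+x. 0 \<partial>M)"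
  proof (rule nn_integral_dominated_convergence[where w = "\<lambda>x. ennreal (w x)"])
    show "(\<integral>\<^sup>+x. ennreal (w x) \<partial>M) < \<infinity>"
      using integrableD(2)[OF dominated(1)] by (auto simp: less_top)
    show "AE x in M. (\<lambda>n. ennreal ((F n x - f x)\<^sup>2)) \<longlonglongrightarrow> 0"
      using lim
    proof eventually_elim
      case (elim x)
      have "(\<lambda>n. (F n x - f x)\<^sup>2) \<longlonglongrightarrow> (f x - f x)\<^sup>2"
        by (intro tendsto_intros elim)
      then show ?case
        by (simp add: tendsto_ennrealI flip: ennreal_0)
    qed
  qed (use dominated in \<open>auto intro: ennreal_leI\<close>)
  then show ?thesis
    by (simp add: L2_sqdist_def)
qed

lemma nn_integral_lborel_reflect:
  fixes f :: "'a::euclidean_space \<Rightarrow> ennreal"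
  assumes "f \<in> borel_measurable borel"
  shows "(\<integral>\<^sup>+p. f (z - p) \<partial>lborel) = (\<integral>\<^sup>+p. f p \<partial>lborel)"
proof -
  have "lborel = distr lborel borel ((-) z)"
    using lborel_affine[of "- 1" z] by (simp add: density_1)
  then show ?thesis
    using nn_integral_distr[of "(-) z" lborel borel f] assms by simp
qed

lemma nn_integral_lborel_translate:
  fixes f :: "'a::euclidean_space \<Rightarrow> ennreal"
  assumes "f \<in> borel_measurable borel"
  shows "(\<integral>\<^sup>+p. f (p + c) \<partial>lborel) = (\<integral>\<^sup>+p. f p \<partial>lborel)"
  using nn_integral_distr[of "(+) c" lborel borel f] assms
  by (simp add: lborel_distr_plus add.commute)

section \<open>Continuity of translations in the mean\<close>

definition truncate :: "real \<Rightarrow> ('a::real_normed_vector \<Rightarrow> real) \<Rightarrow> 'a \<Rightarrow> real" where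
  "truncate N f p = max 0 (min 1 (N + 1 - norm p)) * max (- N) (min N (f p))"

lemma continuous_on_truncate:
  "continuous_on A f \<Longrightarrow> continuous_on A (truncate N f)"
  unfolding truncate_def by (intro continuous_intros)

lemma borel_measurable_truncate [measurable]:
  fixes f :: "'a::euclidean_space \<Rightarrow> real"
  assumes [measurable]: "f \<in> borel_measurable borel"
  shows "truncate N f \<in> borel_measurable borel"
  unfolding truncate_def by measurable

lemma truncate_eq: "norm p \<le> N \<Longrightarrow> \<bar>f p\<bar> \<le> N \<Longrightarrow> truncate N f p = f p"
  by (auto simp: truncate_def)

lemma truncate_eq_0: "N + 1 \<le> norm p \<Longrightarrow> truncate N f p = 0"
  by (simp add: truncate_def)

lemma abs_truncate_le:
  assumes "0 \<le> N"
  shows "\<bar>truncate N f p\<bar> \<le> N"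
proof -
  have "\<bar>truncate N f p\<bar> \<le> 1 * N"
    unfolding truncate_def abs_mult using assms by (intro mult_mono) auto
  then show ?thesis by simp
qed

lemma abs_truncate_diff_le:
  assumes "0 \<le> N"
  shows "\<bar>truncate N f p - f p\<bar> \<le> \<bar>f p\<bar>"
proof -
  define c where "c = max 0 (min 1 (N + 1 - norm p))"
  define y where "y = max (- N) (min N (f p))"
  have c_range: "0 \<le> c" "c \<le> 1"
    by (auto simp: c_def)
  have "0 \<le> f p \<Longrightarrow> 0 \<le> y \<and> y \<le> f p" "f p \<le> 0 \<Longrightarrow> f p \<le> y \<and> y \<le> 0"
    using assms by (auto simp: y_def)
  then have "\<bar>c * y - f p\<bar> \<le> \<bar>f p\<bar>"
    using c_range mult_left_le_one_le[of y c] mult_left_le_one_le[of "- y" c]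
      mult_nonneg_nonneg[of c y] mult_nonneg_nonneg[of c "- y"] by (cases "0 \<le> f p") auto
  then show ?thesis
    by (simp add: truncate_def c_def y_def)
qed

lemma L2_sqdist_truncate_tendsto_0:
  fixes f :: "'a::euclidean_space \<Rightarrow> real"
  assumes [measurable]: "f \<in> borel_measurable borel" and f_square: "integrable lborel (\<lambda>p. (f p)\<^sup>2)"
  shows "(\<lambda>n. L2_sqdist lborel (truncate (real n) f) f) \<longlonglongrightarrow> 0"
proof (rule L2_sqdist_tendsto_0[OF _ _ _ f_square])
  have "(\<lambda>n. truncate (real n) f p) \<longlonglongrightarrow> f p" for p
  proof (rule tendsto_eventually)
    obtain m where m_ge: "\<bar>f p\<bar> + norm p \<le> real m"
      using real_arch_simple by blast
    show "\<forall>\<^sub>F n in sequentially. truncate (real n) f p = f p"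
      using eventually_ge_at_top[of m]
    proof eventually_elim
      case (elim n)
      then have "\<bar>f p\<bar> + norm p \<le> real n"
        using m_ge by linarith
      then have "norm p \<le> real n" "\<bar>f p\<bar> \<le> real n"
        using norm_ge_zero[of p] by linarith+
      then show ?case
        by (rule truncate_eq)
    qed
  qed
  then show "AE p in lborel. (\<lambda>n. truncate (real n) f p) \<longlonglongrightarrow> f p"
    by simp
  show "(truncate (real n) f p - f p)\<^sup>2 \<le> (f p)\<^sup>2" for n p
    using abs_truncate_diff_le[of "real n" f p] abs_le_square_iff by auto
qed simp_all

lemma L2_sqdist_truncate_AE_tendsto_0:
  fixes h :: "nat \<Rightarrow> 'a::euclidean_space \<Rightarrow> real"
  assumes [measurable]: "\<And>n. h n \<in> borel_measurable borel" "f \<in> borel_measurable borel"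
    and lim: "AE p in lborel. (\<lambda>n. h n p) \<longlonglongrightarrow> f p" and N_nonneg: "0 \<le> N"
  shows "(\<lambda>n. L2_sqdist lborel (truncate N (h n)) (truncate N f)) \<longlonglongrightarrow> 0"
proof (rule L2_sqdist_tendsto_0)
  show "AE p in lborel. (\<lambda>n. truncate N (h n) p) \<longlonglongrightarrow> truncate N f p"
    using lim unfolding truncate_def by eventually_elim (intro tendsto_intros)
  show "integrable lborel (\<lambda>p::'a. (2 * N)\<^sup>2 * indicator (cball 0 (N + 1)) p)"
    by (intro integrable_mult_right integrable_real_indicator emeasure_lborel_cball_finite) simp
  show "(truncate N (h n) p - truncate N f p)\<^sup>2 \<le> (2 * N)\<^sup>2 * indicator (cball 0 (N + 1)) p" for n p
  proof (cases "p \<in> cball 0 (N + 1)")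
    case True
    have "\<bar>truncate N (h n) p - truncate N f p\<bar> \<le> 2 * N"
      using abs_truncate_le[OF N_nonneg, of "h n" p] abs_truncate_le[OF N_nonneg, of f p]
      by linarith
    then show ?thesis
      using True power_mono[of "\<bar>truncate N (h n) p - truncate N f p\<bar>" "2 * N" 2] by simp
  qed (simp add: truncate_eq_0)
qed simp_all

lemma borel_measurable_AE_limit_continuous:
  fixes f :: "'a::euclidean_space \<Rightarrow> real"
  assumes "f \<in> borel_measurable borel"
  obtains h where "\<And>n. continuous_on UNIV (h n)" "AE p in lborel. (\<lambda>n. h n p) \<longlonglongrightarrow> f p"
proof -
  have "f measurable_on UNIV"
    using assms
    by (intro lebesgue_measurable_imp_measurable_on_real) (auto intro: measurable_completion)
  then obtain N h where N_negligible: "negligible N"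
    and h: "\<And>n. continuous_on UNIV (h n :: 'a \<Rightarrow> real)"
    and lim: "\<And>p. p \<notin> N \<Longrightarrow> (\<lambda>n. h n p) \<longlonglongrightarrow> f p"
    unfolding measurable_on_def by auto
  have "AE p in lebesgue. p \<notin> N"
    using N_negligible by (simp add: AE_not_in negligible_iff_null_sets)
  then have "AE p in lebesgue. (\<lambda>n. h n p) \<longlonglongrightarrow> f p"
    by eventually_elim (rule lim)
  then show thesis
    using that[OF h] by (simp add: AE_completion_iff)
qed

lemma ex_less_ennreal_null_sequence:
  fixes X :: "nat \<Rightarrow> ennreal"
  assumes "X \<longlonglongrightarrow> 0" "0 < e"
  obtains n where "X n < e"
  using order_tendstoD(2)[OF assms] by (auto simp: eventually_sequentially)

lemma L2_dense_continuous_compact_support: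
  fixes f :: "'a::euclidean_space \<Rightarrow> real"
  assumes f [measurable]: "f \<in> borel_measurable borel"
    and f_square: "integrable lborel (\<lambda>p. (f p)\<^sup>2)"
    and e_pos: "0 < e"
  obtains g R where "continuous_on UNIV g" "\<And>p. R \<le> norm p \<Longrightarrow> g p = 0"
    "L2_sqdist lborel g f \<le> ennreal e"
proof -
  obtain h where h: "\<And>n. continuous_on UNIV (h n)" and lim: "AE p in lborel. (\<lambda>n. h n p) \<longlonglongrightarrow> f p"
    using borel_measurable_AE_limit_continuous[OF f] by blast
  have [measurable]: "h n \<in> borel_measurable borel" for n
    by (rule borel_measurable_continuous_onI[OF h])
  have quarter_pos: "0 < ennreal (e / 4)"
    using e_pos by simp
  obtain m where m_close: "L2_sqdist lborel (truncate (real m) f) f < ennreal (e / 4)"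
    using ex_less_ennreal_null_sequence L2_sqdist_truncate_tendsto_0[OF f f_square] quarter_pos
    by blast
  have "(\<lambda>n. L2_sqdist lborel (truncate (real m) (h n)) (truncate (real m) f)) \<longlonglongrightarrow> 0"
    by (intro L2_sqdist_truncate_AE_tendsto_0 lim) auto
  then obtain n
    where n_close: "L2_sqdist lborel (truncate (real m) (h n)) (truncate (real m) f) < ennreal (e / 4)"
    using ex_less_ennreal_null_sequence quarter_pos by blast
  show thesis
  proof
    show "continuous_on UNIV (truncate (real m) (h n))"
      by (intro continuous_on_truncate h)
    show "truncate (real m) (h n) p = 0" if "real m + 1 \<le> norm p" for p
      using that by (rule truncate_eq_0)
    have "L2_sqdist lborel (truncate (real m) (h n)) f \<le> ennreal (2 * (e / 4) + 2 * (e / 4))"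
      by (rule L2_sqdist_triangle_le[OF _ _ _ less_imp_le[OF n_close] less_imp_le[OF m_close]])
         (use e_pos in auto)
    then show "L2_sqdist lborel (truncate (real m) (h n)) f \<le> ennreal e"
      by simp
  qed
qed

lemma L2_sqdist_translate:
  fixes f g :: "'a::euclidean_space \<Rightarrow> real"
  assumes "f \<in> borel_measurable borel" "g \<in> borel_measurable borel"
  shows "L2_sqdist lborel (\<lambda>p. f (p + h)) (\<lambda>p. g (p + h)) = L2_sqdist lborel f g"
  using nn_integral_lborel_translate[of "\<lambda>p. ennreal ((f p - g p)\<^sup>2)" h] assms
  by (simp add: L2_sqdist_def)

lemma uniformly_continuous_compact_support:
  fixes g :: "'a::euclidean_space \<Rightarrow> real"
  assumes g: "continuous_on UNIV g" "\<And>p. R \<le> norm p \<Longrightarrow> g p = 0"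
  shows "uniformly_continuous_on UNIV g"
  unfolding uniformly_continuous_on_def
proof (intro allI impI)
  fix e :: real assume e_pos: "0 < e"
  have "uniformly_continuous_on (cball 0 (R + 1)) g"
    by (intro compact_uniformly_continuous continuous_on_subset[OF g(1)]) auto
  then obtain d where modulus: "0 < d" "\<And>p q. p \<in> cball 0 (R + 1) \<Longrightarrow> q \<in> cball 0 (R + 1) \<Longrightarrow>
      dist q p < d \<Longrightarrow> dist (g q) (g p) < e"
    unfolding uniformly_continuous_on_def using e_pos by metis
  have "dist (g q) (g p) < e" if near: "dist q p < min d 1" for p q
  proof (cases "p \<in> cball 0 (R + 1) \<and> q \<in> cball 0 (R + 1)")
    case False
    moreover have "\<bar>norm q - norm p\<bar> < 1"
      using norm_triangle_ineq3[of q p] near by (simp add: dist_norm)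
    ultimately have "R \<le> norm p" "R \<le> norm q"
      unfolding mem_cball_0 by linarith+
    then show ?thesis
      using e_pos by (simp add: g(2))
  qed (use modulus(2) near in simp)
  then show "\<exists>d>0. \<forall>p\<in>UNIV. \<forall>q\<in>UNIV. dist q p < d \<longrightarrow> dist (g q) (g p) < e"
    using modulus(1) by (intro exI[of _ "min d 1"]) auto
qed

lemma L2_sqdist_le_emeasure:
  assumes [measurable]: "S \<in> sets M"
    and close: "\<And>x. x \<in> S \<Longrightarrow> \<bar>f x - g x\<bar> \<le> c" and equal_outside: "\<And>x. x \<notin> S \<Longrightarrow> f x = g x"
  shows "L2_sqdist M f g \<le> ennreal (c\<^sup>2) * emeasure M S"
proof -
  have "ennreal ((f x - g x)\<^sup>2) \<le> ennreal (c\<^sup>2) * indicator S x" for x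
    using power_mono[OF close, of x 2] equal_outside[of x]
    by (cases "x \<in> S") (auto intro: ennreal_leI)
  then have "L2_sqdist M f g \<le> (\<integral>\<^sup>+x. ennreal (c\<^sup>2) * indicator S x \<partial>M)"
    unfolding L2_sqdist_def by (rule nn_integral_mono)
  then show ?thesis
    by (simp add: nn_integral_cmult_indicator)
qed

lemma L2_translation_continuous_compact_support:
  fixes g :: "'a::euclidean_space \<Rightarrow> real"
  assumes g: "continuous_on UNIV g" "\<And>p. R \<le> norm p \<Longrightarrow> g p = 0" and e_pos: "0 < e"
  obtains d where "0 < d" "\<And>h. norm h < d \<Longrightarrow> L2_sqdist lborel (\<lambda>p. g (p + h)) g \<le> ennreal e"
proof -
  define S where "S = cball (0 :: 'a) (R + 1)"
  define c where "c = sqrt (e / (measure lborel S + 1))"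
  have emeasure_S: "emeasure lborel S = ennreal (measure lborel S)"
    unfolding S_def using emeasure_lborel_cball_finite
    by (intro emeasure_eq_ennreal_measure) (auto simp: less_top)
  have "0 < measure lborel S + 1"
    by (simp add: add_nonneg_pos)
  then have c_choice: "0 < c" "c\<^sup>2 * (measure lborel S + 1) = e"
    using e_pos by (simp_all add: c_def)
  obtain d where modulus: "0 < d" "\<And>p q. dist q p < d \<Longrightarrow> dist (g q) (g p) < c"
    using uniformly_continuous_compact_support[OF g] c_choice(1)
    unfolding uniformly_continuous_on_def by (metis UNIV_I)
  show thesis
  proof
    show "0 < min d 1"
      using modulus by simp
    fix h :: 'a assume h_small: "norm h < min d 1"
    have "L2_sqdist lborel (\<lambda>p. g (p + h)) g \<le> ennreal (c\<^sup>2) * emeasure lborel S"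
    proof (rule L2_sqdist_le_emeasure)
      show "\<bar>g (p + h) - g p\<bar> \<le> c" for p
        using modulus(2)[of "p + h" p] h_small by (simp add: dist_norm)
      fix p assume "p \<notin> S"
      then have "R \<le> norm p" "R \<le> norm (p + h)"
        using h_small norm_diff_ineq[of p h] by (auto simp: S_def)
      then show "g (p + h) = g p"
        by (simp add: g(2))
    qed (simp add: S_def)
    also have "\<dots> = ennreal (c\<^sup>2 * measure lborel S)"
      by (simp add: emeasure_S ennreal_mult')
    also have "\<dots> \<le> ennreal e"
      using c_choice(2) zero_le_power2[of c] unfolding distrib_left by (intro ennreal_leI) linarith
    finally show "L2_sqdist lborel (\<lambda>p. g (p + h)) g \<le> ennreal e" .
  qed
qed

lemma L2_translation_continuous:
  fixes f :: "'a::euclidean_space \<Rightarrow> real"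
  assumes f [measurable]: "f \<in> borel_measurable borel"
    and f_square: "integrable lborel (\<lambda>p. (f p)\<^sup>2)"
    and e_pos: "0 < e"
  obtains d where "0 < d" "\<And>h. norm h < d \<Longrightarrow> L2_sqdist lborel (\<lambda>p. f (p + h)) f \<le> ennreal e"
proof -
  have tenth_pos: "0 < e / 10"
    using e_pos by simp
  obtain g R where g: "continuous_on UNIV g" "\<And>p. R \<le> norm p \<Longrightarrow> g p = 0"
    and g_f: "L2_sqdist lborel g f \<le> ennreal (e / 10)"
    using L2_dense_continuous_compact_support[OF f f_square tenth_pos] by blast
  obtain d where modulus: "0 < d"
    "\<And>h. norm h < d \<Longrightarrow> L2_sqdist lborel (\<lambda>p. g (p + h)) g \<le> ennreal (e / 10)"
    using L2_translation_continuous_compact_support[OF g tenth_pos] by blast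
  have [measurable]: "g \<in> borel_measurable borel"
    by (rule borel_measurable_continuous_onI[OF g(1)])
  show thesis
  proof
    fix h :: 'a assume h_small: "norm h < d"
    let ?fh = "\<lambda>p. f (p + h)" and ?gh = "\<lambda>p. g (p + h)"
    have fh_gh: "L2_sqdist lborel ?fh ?gh \<le> ennreal (e / 10)"
      using g_f by (simp add: L2_sqdist_translate L2_sqdist_commute[of _ f])
    have gh_f: "L2_sqdist lborel ?gh f \<le> ennreal (2 * (e / 10) + 2 * (e / 10))"
      by (rule L2_sqdist_triangle_le[OF _ _ _ modulus(2)[OF h_small] g_f]) (use e_pos in simp_all)
    have "L2_sqdist lborel ?fh f \<le> ennreal (2 * (e / 10) + 2 * (2 * (e / 10) + 2 * (e / 10)))"
      by (rule L2_sqdist_triangle_le[OF _ _ _ fh_gh gh_f]) (use e_pos in simp_all)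
    then show "L2_sqdist lborel ?fh f \<le> ennreal e"
      by simp
  qed (rule modulus(1))
qed

section \<open>Mollification\<close>

definition mollifier :: "real \<Rightarrow> ('a::euclidean_space \<Rightarrow> real) \<Rightarrow> bool" where
  "mollifier d k \<longleftrightarrow> (\<forall>p. 0 \<le> k p) \<and> (\<forall>p. d \<le> norm p \<longrightarrow> k p = 0) \<and> has_bochner_integral lborel k 1"

lemma mollifierD:
  fixes k :: "'a::euclidean_space \<Rightarrow> real"
  assumes "mollifier d k"
  shows "k \<in> borel_measurable borel" "0 \<le> k p" "d \<le> norm p \<Longrightarrow> k p = 0"
    "(\<integral>\<^sup>+p. ennreal (k p) \<partial>lborel) = 1"
proof -
  have k_integral: "integrable lborel k" "(\<integral>p. k p \<partial>lborel) = 1" and nonneg: "\<And>p. 0 \<le> k p"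
    using assms by (auto simp: mollifier_def has_bochner_integral_iff)
  show "k \<in> borel_measurable borel"
    using k_integral(1) by auto
  show "(\<integral>\<^sup>+p. ennreal (k p) \<partial>lborel) = 1"
    using k_integral nonneg by (simp add: nn_integral_eq_integral)
qed (use assms in \<open>auto simp: mollifier_def\<close>)

lemma has_bochner_integral_mollifier_reflect:
  fixes k :: "'a::euclidean_space \<Rightarrow> real"
  assumes "mollifier d k"
  shows "has_bochner_integral lborel (\<lambda>p. k (z - p)) 1"
proof (rule has_bochner_integral_nn_integral)
  show "(\<integral>\<^sup>+p. ennreal (k (z - p)) \<partial>lborel) = ennreal 1"
    using mollifierD[OF assms] by (simp add: nn_integral_lborel_reflect[of "\<lambda>p. ennreal (k p)"])
qed (use mollifierD[OF assms] in auto)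

lemma power2_integral_le_weighted:
  fixes g k :: "'a \<Rightarrow> real"
  assumes [measurable]: "g \<in> borel_measurable M" "k \<in> borel_measurable M"
    and k: "\<And>x. 0 \<le> k x" "(\<integral>\<^sup>+x. ennreal (k x) \<partial>M) = 1"
  shows "ennreal ((\<integral>x. g x * k x \<partial>M)\<^sup>2) \<le> (\<integral>\<^sup>+x. ennreal ((g x)\<^sup>2) * ennreal (k x) \<partial>M)"
proof (cases "integrable M (\<lambda>x. g x * k x)")
  case True
  have "ennreal \<bar>\<integral>x. g x * k x \<partial>M\<bar> \<le> (\<integral>\<^sup>+x. ennreal (\<bar>g x\<bar> * sqrt (k x)) * ennreal (sqrt (k x)) \<partial>M)"
    using integral_norm_bound_ennreal[OF True] k(1)
    by (simp add: abs_mult mult.assoc flip: ennreal_mult')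
  then have "(ennreal \<bar>\<integral>x. g x * k x \<partial>M\<bar>)\<^sup>2
      \<le> (\<integral>\<^sup>+x. ennreal (\<bar>g x\<bar> * sqrt (k x)) * ennreal (sqrt (k x)) \<partial>M)\<^sup>2"
    by (rule power_mono) simp
  also have "\<dots> \<le> (\<integral>\<^sup>+x. (ennreal (\<bar>g x\<bar> * sqrt (k x)))\<^sup>2 \<partial>M) * (\<integral>\<^sup>+x. (ennreal (sqrt (k x)))\<^sup>2 \<partial>M)"
    by (rule Cauchy_Schwarz_nn_integral) measurable
  also have "\<dots> = (\<integral>\<^sup>+x. ennreal ((g x)\<^sup>2) * ennreal (k x) \<partial>M)"
    using k by (simp add: ennreal_power power_mult_distrib ennreal_mult')
  finally show ?thesis
    by (simp add: ennreal_power)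
qed (simp add: not_integrable_integral_eq)

lemma L2_sqdist_convolve_le:
  fixes f k :: "'a::euclidean_space \<Rightarrow> real"
  assumes f: "integrable lborel f" and k: "mollifier d k" "bounded (range k)"
    and close: "\<And>h. norm h < d \<Longrightarrow> L2_sqdist lborel (\<lambda>p. f (p + h)) f \<le> e"
  shows "L2_sqdist lborel (convolve f k) f \<le> e"
proof -
  note [measurable] = mollifierD(1)[OF k(1)]
  have [measurable]: "f \<in> borel_measurable borel"
    using f by auto
  have sq_le: "ennreal ((convolve f k z - f z)\<^sup>2)
      \<le> (\<integral>\<^sup>+p. ennreal ((f (z - p) - f z)\<^sup>2) * ennreal (k p) \<partial>lborel)" for z
  proof -
    have "convolve f k z - f z = (\<integral>p. (f p - f z) * k (z - p) \<partial>lborel)"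
      using integrable_convolve[OF f mollifierD(1)[OF k(1)] k(2), of z]
        has_bochner_integral_mollifier_reflect[OF k(1), of z]
      by (simp add: convolve_def left_diff_distrib has_bochner_integral_iff)
    then have "ennreal ((convolve f k z - f z)\<^sup>2)
        \<le> (\<integral>\<^sup>+p. ennreal ((f p - f z)\<^sup>2) * ennreal (k (z - p)) \<partial>lborel)"
      using power2_integral_le_weighted[of "\<lambda>p. f p - f z" lborel "\<lambda>p. k (z - p)"]
        mollifierD[OF k(1)]
      by (simp add: nn_integral_lborel_reflect[of "\<lambda>p. ennreal (k p)"])
    also have "\<dots> = (\<integral>\<^sup>+p. ennreal ((f (z - p) - f z)\<^sup>2) * ennreal (k p) \<partial>lborel)"
      using nn_integral_lborel_reflect[of "\<lambda>p. ennreal ((f (z - p) - f z)\<^sup>2) * ennreal (k p)" z]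
      by simp
    finally show ?thesis .
  qed
  have "L2_sqdist lborel (convolve f k) f
      \<le> (\<integral>\<^sup>+z. \<integral>\<^sup>+p. ennreal ((f (z - p) - f z)\<^sup>2) * ennreal (k p) \<partial>lborel \<partial>lborel)"
    unfolding L2_sqdist_def by (intro nn_integral_mono sq_le)
  also have "\<dots> = (\<integral>\<^sup>+p. \<integral>\<^sup>+z. ennreal ((f (z - p) - f z)\<^sup>2) * ennreal (k p) \<partial>lborel \<partial>lborel)"
    by (rule lborel_pair.Fubini') measurable
  also have "\<dots> = (\<integral>\<^sup>+p. L2_sqdist lborel (\<lambda>z. f (z + - p)) f * ennreal (k p) \<partial>lborel)"
    by (simp add: L2_sqdist_def nn_integral_multc)
  also have "\<dots> \<le> (\<integral>\<^sup>+p. e * ennreal (k p) \<partial>lborel)"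
  proof (intro nn_integral_mono)
    show "L2_sqdist lborel (\<lambda>z. f (z + - p)) f * ennreal (k p) \<le> e * ennreal (k p)" for p
      using close[of "- p"] mollifierD(3)[OF k(1), of p]
      by (cases "norm p < d") (auto intro: mult_right_mono)
  qed
  also have "\<dots> = e"
    by (simp add: nn_integral_cmult mollifierD(4)[OF k(1)])
  finally show ?thesis .
qed

lemma L2_mollification:
  fixes f :: "'a::euclidean_space \<Rightarrow> real"
  assumes f: "integrable lborel f" "integrable lborel (\<lambda>p. (f p)\<^sup>2)" and e_pos: "0 < e"
  obtains d where "0 < d" "\<And>r k. mollifier r k \<Longrightarrow> bounded (range k) \<Longrightarrow> r \<le> d \<Longrightarrow>
    L2_sqdist lborel (convolve f k) f \<le> ennreal e"
proof -
  have "f \<in> borel_measurable borel"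
    using f(1) by auto
  then obtain d where modulus: "0 < d"
    "\<And>h. norm h < d \<Longrightarrow> L2_sqdist lborel (\<lambda>p. f (p + h)) f \<le> ennreal e"
    using L2_translation_continuous f(2) e_pos by blast
  then show thesis
    by (intro that[OF modulus(1)] L2_sqdist_convolve_le[OF f(1)]) auto
qed

section \<open>Gevrey classes\<close>

definition gevrey :: "nat \<Rightarrow> (nat \<Rightarrow> nat \<Rightarrow> 'a \<Rightarrow> real) \<Rightarrow> bool" where
  "gevrey s W \<longleftrightarrow> (\<exists>C R. \<forall>i j p. \<bar>W i j p\<bar> \<le> C * R ^ (i + j) * (fact i * fact j) ^ s)"

lemma gevreyI:
  "(\<And>i j p. \<bar>W i j p\<bar> \<le> C * R ^ (i + j) * (fact i * fact j) ^ s) \<Longrightarrow> gevrey s W"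
  unfolding gevrey_def by blast

lemma gevreyE:
  assumes "gevrey s W"
  obtains C R where "0 \<le> C" "b \<le> R" "\<And>i j p. \<bar>W i j p\<bar> \<le> C * R ^ (i + j) * (fact i * fact j) ^ s"
proof -
  obtain C R where W_bound: "\<And>i j p. \<bar>W i j p\<bar> \<le> C * R ^ (i + j) * (fact i * fact j) ^ s"
    using assms unfolding gevrey_def by blast
  have "\<bar>W i j p\<bar> \<le> \<bar>C\<bar> * (\<bar>b\<bar> + \<bar>R\<bar>) ^ (i + j) * (fact i * fact j) ^ s" for i j p
  proof -
    have "C * R ^ (i + j) \<le> \<bar>C\<bar> * \<bar>R\<bar> ^ (i + j)"
      by (metis abs_ge_self abs_mult power_abs)
    also have "\<dots> \<le> \<bar>C\<bar> * (\<bar>b\<bar> + \<bar>R\<bar>) ^ (i + j)"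
      by (intro mult_left_mono power_mono) auto
    finally have "C * R ^ (i + j) * (fact i * fact j) ^ s
        \<le> \<bar>C\<bar> * (\<bar>b\<bar> + \<bar>R\<bar>) ^ (i + j) * (fact i * fact j) ^ s"
      by (intro mult_right_mono) auto
    then show ?thesis
      using W_bound[of i j p] by linarith
  qed
  then show thesis
    by (rule that[of "\<bar>C\<bar>" "\<bar>b\<bar> + \<bar>R\<bar>", rotated 2]) auto
qed

lemma gevrey_imp_bounded: "gevrey s W \<Longrightarrow> bounded (range (W i j))"
  unfolding gevrey_def bounded_iff by fastforce

lemma gevrey_cmult:
  assumes "gevrey s W"
  shows "gevrey s (\<lambda>i j p. c * W i j p)"
proof -
  obtain C R where "\<And>i j p. \<bar>W i j p\<bar> \<le> C * R ^ (i + j) * (fact i * fact j) ^ s"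
    using gevreyE[OF assms] by metis
  then have "\<bar>c * W i j p\<bar> \<le> \<bar>c\<bar> * C * R ^ (i + j) * (fact i * fact j) ^ s" for i j p
    using mult_left_mono[of "\<bar>W i j p\<bar>" _ "\<bar>c\<bar>"] by (simp add: abs_mult mult.assoc)
  then show ?thesis
    by (rule gevreyI)
qed

lemma gevrey_convolve:
  assumes f: "integrable lborel f" and K: "gevrey s K" "\<And>i j. K i j \<in> borel_measurable borel"
  shows "gevrey s (\<lambda>i j. convolve f (K i j))"
proof -
  obtain C R where "\<And>i j p. \<bar>K i j p\<bar> \<le> C * R ^ (i + j) * (fact i * fact j) ^ s"
    using gevreyE[OF K(1)] by metis
  then have "\<bar>convolve f (K i j) z\<bar> \<le> C * R ^ (i + j) * (fact i * fact j) ^ s * (\<integral>p. \<bar>f p\<bar> \<partial>lborel)"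
    for i j z
    by (rule abs_convolve_le[OF f K(2)])
  then show ?thesis
    by (intro gevreyI[where C = "C * (\<integral>p. \<bar>f p\<bar> \<partial>lborel)" and R = R]) (simp add: mult_ac)
qed

section \<open>A Gevrey bump function\<close>

definition cbump :: "complex \<Rightarrow> complex" where
  "cbump z = exp (- inverse (1 - z) - inverse (1 + z))"

definition bump_deriv :: "nat \<Rightarrow> real \<Rightarrow> real" where
  "bump_deriv k t = (if \<bar>t\<bar> < 1 then Re ((deriv ^^ k) cbump (of_real t)) else 0)"

lemma open_cbump_domain: "open (- {1, -1::complex})"
  by (intro open_Compl finite_imp_closed) auto

lemma holomorphic_cbump: "cbump holomorphic_on (- {1, -1})"
proof -
  have "1 - z \<noteq> 0 \<and> 1 + z \<noteq> 0" if "z \<in> - {1, -1}" for z :: complex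
    using that by (auto simp: add_eq_0_iff minus_equation_iff)
  then show ?thesis
    unfolding cbump_def by (intro holomorphic_intros) auto
qed

lemma Re_inverse_ge:
  assumes d_pos: "0 < d" and z_near: "cmod (z - of_real d) \<le> d / 2"
  shows "2 / (9 * d) \<le> Re (inverse z)"
proof -
  have "\<bar>Re (z - of_real d)\<bar> \<le> d / 2"
    using abs_Re_le_cmod z_near by (rule order_trans)
  then have Re_z: "d / 2 \<le> Re z"
    by (simp add: abs_if split: if_splits)
  have "cmod z \<le> cmod (of_real d) + cmod (z - of_real d)"
    by (metis add.commute diff_add_cancel norm_triangle_ineq)
  then have "cmod z \<le> 3 * d / 2"
    using d_pos z_near by simp
  then have cmod_z: "(cmod z)\<^sup>2 \<le> (3 * d / 2)\<^sup>2"
    by (intro power_mono) auto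
  have cmod_z_pos: "0 < (cmod z)\<^sup>2"
    using Re_z d_pos by auto
  have "2 / (9 * d) = (d / 2) / (3 * d / 2)\<^sup>2"
    using d_pos by (simp add: field_simps power2_eq_square)
  also have "\<dots> \<le> Re z / (cmod z)\<^sup>2"
    using Re_z cmod_z d_pos cmod_z_pos by (intro frac_le) auto
  finally show ?thesis
    by (simp add: cmod_power2)
qed

lemma cmod_cbump_le:
  assumes t_inside: "\<bar>t\<bar> < 1" and z_near: "cmod (z - of_real t) \<le> (1 - \<bar>t\<bar>) / 2"
  shows "cmod (cbump z) \<le> exp (- (2 / (9 * (1 - \<bar>t\<bar>))))"
proof -
  have "2 / (9 * (1 - t)) \<le> Re (inverse (1 - z))"
    using t_inside z_near by (intro Re_inverse_ge) (auto simp: norm_minus_commute)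
  moreover have "2 / (9 * (1 + t)) \<le> Re (inverse (1 + z))"
    using t_inside z_near by (intro Re_inverse_ge) auto
  moreover have "2 / (9 * (1 - \<bar>t\<bar>)) \<le> 2 / (9 * (1 - t)) + 2 / (9 * (1 + t))"
    using t_inside by (auto simp: abs_if)
  ultimately show ?thesis
    unfolding cbump_def norm_exp_eq_Re by simp
qed

lemma power_le_fact_mult_exp:
  assumes "0 \<le> (y::real)"
  shows "y ^ m \<le> fact m * exp y"
proof -
  have "y ^ m /\<^sub>R fact m \<le> exp y"
    using sum_le_suminf[OF summable_exp_generic[of y], of "{m}"] assms by (simp add: exp_def)
  then show ?thesis
    by (simp add: field_simps)
qed

lemma exp_minus_le_fact:
  assumes "0 < (y::real)"
  shows "exp (- y) \<le> fact m / y ^ m"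
  using power_le_fact_mult_exp[of y m] assms by (simp add: exp_minus field_simps)

text \<open>Cauchy's estimate on the disc of radius \<open>(1 - \<bar>t\<bar>) / 2\<close>; the exponential decay at the end points
  absorbs the radius and \<open>m\<close> further powers of \<open>1 - \<bar>t\<bar>\<close>.\<close>

lemma abs_bump_deriv_le_power:
  assumes t_inside: "\<bar>t\<bar> < 1"
  shows "\<bar>bump_deriv k t\<bar> \<le> fact k * fact (k + m) * 9 ^ (k + m) * (1 - \<bar>t\<bar>) ^ m"
proof -
  define d where "d = 1 - \<bar>t\<bar>"
  have d_pos: "0 < d" using t_inside by (simp add: d_def)
  have "cmod (of_real t - 1) = \<bar>t - 1\<bar>" "cmod (of_real t + 1) = \<bar>t + 1\<bar>"
    by (metis norm_of_real of_real_1 of_real_diff of_real_add)+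
  then have disc: "cball (of_real t) (d / 2) \<subseteq> - {1, -1::complex}"
    using t_inside by (auto simp: dist_norm d_def)
  have "cmod ((deriv ^^ k) cbump (of_real t)) \<le> fact k * exp (- (2 / (9 * d))) / (d / 2) ^ k"
  proof (rule Cauchy_inequality)
    show "cbump holomorphic_on ball (of_real t) (d / 2)"
      by (rule holomorphic_on_subset[OF holomorphic_cbump]) (use disc ball_subset_cball in blast)
    show "continuous_on (cball (of_real t) (d / 2)) cbump"
      by (intro holomorphic_on_imp_continuous_on holomorphic_on_subset[OF holomorphic_cbump disc])
    show "cmod (cbump x) \<le> exp (- (2 / (9 * d)))" if "cmod (of_real t - x) = d / 2" for x
      using cmod_cbump_le[OF t_inside, of x] that by (simp add: d_def norm_minus_commute)
  qed (use d_pos in auto)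
  also have "\<dots> \<le> fact k * (fact (k + m) / (2 / (9 * d)) ^ (k + m)) / (d / 2) ^ k"
    using d_pos by (intro divide_right_mono mult_left_mono exp_minus_le_fact) auto
  also have "\<dots> = fact k * fact (k + m) * 9 ^ (k + m) * d ^ m / 2 ^ m"
    using d_pos by (simp add: field_simps power_add)
  also have "\<dots> \<le> fact k * fact (k + m) * 9 ^ (k + m) * d ^ m / 1"
    using d_pos by (intro divide_left_mono) auto
  finally have "cmod ((deriv ^^ k) cbump (of_real t)) \<le> fact k * fact (k + m) * 9 ^ (k + m) * d ^ m"
    by simp
  then show ?thesis
    using t_inside abs_Re_le_cmod[of "(deriv ^^ k) cbump (of_real t)"]
    unfolding bump_deriv_def d_def by simp
qed

lemma bump_deriv_eq_0: "1 \<le> \<bar>t\<bar> \<Longrightarrow> bump_deriv k t = 0"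
  by (simp add: bump_deriv_def)

lemma abs_bump_deriv_le: "\<bar>bump_deriv k t\<bar> \<le> 9 ^ k * (fact k)\<^sup>2"
proof (cases "\<bar>t\<bar> < 1")
  case True
  then show ?thesis
    using abs_bump_deriv_le_power[of t k 0] by (simp add: power2_eq_square mult.commute)
qed (simp add: bump_deriv_eq_0)

lemma has_real_derivative_0_if_quadratic_bound:
  fixes f :: "real \<Rightarrow> real"
  assumes "f a = 0" and "\<And>x. \<bar>f x\<bar> \<le> C * (x - a)\<^sup>2"
  shows "(f has_real_derivative 0) (at a)"
proof -
  have "((\<lambda>x. (f x - f a) / (x - a)) \<longlongrightarrow> 0) (at a)"
  proof (rule Lim_null_comparison)
    have "norm ((f x - f a) / (x - a)) \<le> C * \<bar>x - a\<bar>" if "x \<noteq> a" for x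
      using assms(2)[of x] \<open>f a = 0\<close> that
      by (simp add: divide_simps) (simp add: power2_eq_square abs_mult_self_eq mult.assoc)
    then show "\<forall>\<^sub>F x in at a. norm ((f x - f a) / (x - a)) \<le> C * \<bar>x - a\<bar>"
      by (simp add: eventually_at_filter)
    have "((\<lambda>x. C * \<bar>x - a\<bar>) \<longlongrightarrow> C * \<bar>a - a\<bar>) (at a)"
      by (intro tendsto_intros)
    then show "((\<lambda>x. C * \<bar>x - a\<bar>) \<longlongrightarrow> 0) (at a)"
      by simp
  qed
  then show ?thesis
    by (simp add: has_field_derivative_iff)
qed

lemma bump_deriv_has_real_derivative_inside:
  assumes "\<bar>t\<bar> < 1"
  shows "(bump_deriv k has_real_derivative bump_deriv (Suc k) t) (at t)"
proof (rule has_field_derivative_transform_within_open)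
  have "of_real t \<in> - {1, -1::complex}"
    using assms by (auto simp: complex_eq_iff)
  then have
    "((deriv ^^ k) cbump has_field_derivative (deriv ^^ Suc k) cbump (of_real t)) (at (of_real t))"
    by (intro has_field_derivative_higher_deriv[OF holomorphic_cbump open_cbump_domain])
  then have "((\<lambda>x. Re ((deriv ^^ k) cbump (of_real x))) has_real_derivative
      Re ((deriv ^^ Suc k) cbump (of_real t))) (at t)"
    by (intro has_field_derivative_Re has_vector_derivative_real_field)
  then show
    "((\<lambda>x. Re ((deriv ^^ k) cbump (of_real x))) has_real_derivative bump_deriv (Suc k) t) (at t)"
    using assms by (simp add: bump_deriv_def)
  show "open {-1<..<1::real}"
    by (rule open_greaterThanLessThan)
qed (use assms in \<open>auto simp: bump_deriv_def abs_less_iff\<close>)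

lemma bump_deriv_has_real_derivative_boundary:
  assumes t_boundary: "\<bar>t\<bar> = 1"
  shows "(bump_deriv k has_real_derivative 0) (at t)"
proof (rule has_real_derivative_0_if_quadratic_bound)
  define C :: real where "C = fact k * fact (k + 2) * 9 ^ (k + 2)"
  have C_nonneg: "0 \<le> C" by (simp add: C_def)
  show "bump_deriv k t = 0"
    using t_boundary by (simp add: bump_deriv_eq_0)
  show "\<bar>bump_deriv k x\<bar> \<le> C * (x - t)\<^sup>2" for x
  proof (cases "\<bar>x\<bar> < 1")
    case True
    have "\<bar>bump_deriv k x\<bar> \<le> C * (1 - \<bar>x\<bar>)\<^sup>2"
      using abs_bump_deriv_le_power[OF True, of k 2] by (simp add: C_def)
    also have "\<dots> \<le> C * \<bar>x - t\<bar>\<^sup>2"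
      using True t_boundary C_nonneg by (intro mult_left_mono power_mono) auto
    finally show ?thesis by simp
  qed (use C_nonneg in \<open>simp add: bump_deriv_eq_0\<close>)
qed

lemma bump_deriv_has_real_derivative:
  "(bump_deriv k has_real_derivative bump_deriv (Suc k) t) (at t)"
proof -
  consider (inside) "\<bar>t\<bar> < 1" | (boundary) "\<bar>t\<bar> = 1" | (outside) "1 < \<bar>t\<bar>"
    by linarith
  then show ?thesis
  proof cases
    case inside
    then show ?thesis
      by (rule bump_deriv_has_real_derivative_inside)
  next
    case boundary
    then show ?thesis
      using bump_deriv_has_real_derivative_boundary[of t k] by (simp add: bump_deriv_eq_0)
  next
    case outside
    have "open {x::real. 1 < \<bar>x\<bar>}"
      by (intro open_Collect_less continuous_intros)
    then have "(bump_deriv k has_real_derivative 0) (at t)"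
      using outside by (intro has_field_derivative_transform_within_open[OF DERIV_const])
        (auto simp: bump_deriv_eq_0)
    then show ?thesis
      using outside by (simp add: bump_deriv_eq_0)
  qed
qed

lemma bump_deriv_0_pos:
  assumes "\<bar>t\<bar> < 1"
  shows "0 < bump_deriv 0 t"
proof -
  have "cbump (of_real t) = of_real (exp (- inverse (1 - t) - inverse (1 + t)))"
    by (simp add: cbump_def flip: exp_of_real)
  then show ?thesis
    using assms by (simp add: bump_deriv_def)
qed

lemma bump_deriv_0_nonneg: "0 \<le> bump_deriv 0 t"
  using bump_deriv_0_pos[of t] bump_deriv_eq_0[of t 0] by fastforce

section \<open>Existence of Gevrey mollifiers\<close>

lemma smooth_family_tensor_product:
  fixes a b :: "nat \<Rightarrow> real \<Rightarrow> real"
  assumes a_deriv: "\<And>i t. (a i has_real_derivative a (Suc i) t) (at t)"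
    and b_deriv: "\<And>j x. (b j has_real_derivative b (Suc j) x) (at x)"
  shows "smooth_family (\<lambda>i j p. a i (fst p) * b j (snd p))"
  unfolding smooth_family_def
proof (intro allI conjI)
  fix i j t x
  let ?D = "\<lambda>i j p. a i (fst p) * b j (snd p)"
  have "continuous_on UNIV (a i)"
    by (rule DERIV_continuous_on[OF has_field_derivative_at_within[OF a_deriv]])
  moreover have "continuous_on UNIV (b j)"
    by (rule DERIV_continuous_on[OF has_field_derivative_at_within[OF b_deriv]])
  ultimately show "continuous_on UNIV (?D i j)"
    by (intro continuous_on_mult; elim continuous_on_compose2)
       (simp_all add: continuous_on_fst continuous_on_snd)
  show "((\<lambda>s. ?D i j (s, x)) has_real_derivative ?D (Suc i) j (t, x)) (at t)"
    by (simp add: DERIV_cmult_right[OF a_deriv])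
  show "((\<lambda>y. ?D i j (t, y)) has_real_derivative ?D i (Suc j) (t, x)) (at x)"
    by (simp add: DERIV_cmult[OF b_deriv])
qed

definition bump_kernel :: "real \<Rightarrow> nat \<Rightarrow> nat \<Rightarrow> real \<times> real \<Rightarrow> real" where
  "bump_kernel d i j p = bump_deriv i (fst p / d) / d ^ i * (bump_deriv j (snd p / d) / d ^ j)"

lemma smooth_family_bump_kernel:
  assumes "0 < d"
  shows "smooth_family (bump_kernel d)"
proof -
  have "((\<lambda>t. bump_deriv i (t / d) / d ^ i)
      has_real_derivative bump_deriv (Suc i) (t / d) / d ^ Suc i) (at t)" for i t
    using assms
    by (auto intro!: derivative_eq_intros DERIV_chain2[OF bump_deriv_has_real_derivative])
  then show ?thesis
    unfolding bump_kernel_def by (intro smooth_family_tensor_product)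
qed

lemma gevrey_bump_kernel:
  assumes "0 < d"
  shows "gevrey 2 (bump_kernel d)"
proof (rule gevreyI)
  fix i j p
  have "\<bar>bump_deriv k t / d ^ k\<bar> \<le> (9 / d) ^ k * (fact k)\<^sup>2" for k t
    using assms abs_bump_deriv_le[of k t] by (simp add: power_divide divide_right_mono)
  then have "\<bar>bump_kernel d i j p\<bar> \<le> ((9 / d) ^ i * (fact i)\<^sup>2) * ((9 / d) ^ j * (fact j)\<^sup>2)"
    unfolding bump_kernel_def abs_mult[of "_ / _"] using assms by (intro mult_mono) auto
  then show "\<bar>bump_kernel d i j p\<bar> \<le> 1 * (9 / d) ^ (i + j) * (fact i * fact j)\<^sup>2"
    by (simp add: power_add power_mult_distrib mult_ac)
qed

lemma bump_kernel_eq_0: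
  assumes d_pos: "0 < d" and p_far: "2 * d \<le> norm p"
  shows "bump_kernel d i j p = 0"
proof -
  have "norm p \<le> \<bar>fst p\<bar> + \<bar>snd p\<bar>"
    using norm_Pair_le[of "fst p" "snd p"] by simp
  then have "d \<le> \<bar>fst p\<bar> \<or> d \<le> \<bar>snd p\<bar>"
    using p_far by linarith
  then show ?thesis
    using d_pos by (auto simp: bump_kernel_def bump_deriv_eq_0)
qed

lemma integral_pos_continuous:
  fixes k :: "'a::euclidean_space \<Rightarrow> real"
  assumes k: "continuous_on UNIV k" "integrable lborel k" "\<And>p. 0 \<le> k p" and k_pos: "0 < k z"
  shows "0 < (\<integral>p. k p \<partial>lborel)"
proof -
  have "\<not> (AE p in lborel. k p = 0)"
  proof
    assume "AE p in lborel. k p = 0"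
    then have "AE p in lebesgue. p \<notin> {p. 0 < k p}"
      by (intro AE_completion) (auto elim: eventually_mono)
    moreover have "open {p. 0 < k p}"
      by (intro open_Collect_less continuous_on_const k(1))
    ultimately have "negligible {p. 0 < k p}"
      by (subst (asm) AE_iff_null_sets[symmetric]) (auto simp: negligible_iff_null_sets)
    then show False
      using open_not_negligible[OF \<open>open {p. 0 < k p}\<close>] k_pos by auto
  qed
  then show ?thesis
    using integral_nonneg_eq_0_iff_AE[OF k(2)] k(3) integral_nonneg_AE[of k lborel]
    by (simp add: less_le)
qed

lemma ex_gevrey_mollifier:
  assumes d_pos: "0 < d"
  obtains K :: "nat \<Rightarrow> nat \<Rightarrow> real \<times> real \<Rightarrow> real"
  where "smooth_family K" "gevrey 2 K" "mollifier d (K 0 0)"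
proof -
  define k where "k = bump_kernel (d / 2)"
  define I where "I = (\<integral>p. k 0 0 p \<partial>lborel)"
  have smooth: "smooth_family k" and gevrey: "gevrey 2 k"
    using d_pos by (simp_all add: k_def smooth_family_bump_kernel gevrey_bump_kernel)
  have nonneg: "0 \<le> k 0 0 p" for p
    by (simp add: k_def bump_kernel_def bump_deriv_0_nonneg)
  have outside: "k 0 0 p = 0" if "d \<le> norm p" for p
    using bump_kernel_eq_0[of "d / 2" p] d_pos that by (simp add: k_def)
  have integrable: "integrable lborel (k 0 0)"
    by (rule integrable_continuous_compact_support[where S = "cball 0 d",
        OF smooth_familyD(1)[OF smooth]]) (use outside in auto)
  have "0 < k 0 0 0"
    by (simp add: k_def bump_kernel_def bump_deriv_0_pos)
  then have I_pos: "0 < I"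
    unfolding I_def
    by (rule integral_pos_continuous[OF smooth_familyD(1)[OF smooth] integrable nonneg])
  show thesis
  proof
    show "smooth_family (\<lambda>i j p. (1 / I) * k i j p)" "gevrey 2 (\<lambda>i j p. (1 / I) * k i j p)"
      by (intro smooth_family_cmult smooth gevrey_cmult gevrey)+
    have "has_bochner_integral lborel (\<lambda>p. (1 / I) * k 0 0 p) ((1 / I) * I)"
      unfolding I_def
      by (intro has_bochner_integral_mult_right has_bochner_integral_integrable integrable)
    then show "mollifier d (\<lambda>p. (1 / I) * k 0 0 p)"
      using I_pos nonneg outside by (simp add: mollifier_def)
  qed
qed

section \<open>Exponential generating functions\<close>

definition egf :: "(nat \<Rightarrow> real) \<Rightarrow> real \<Rightarrow> real" where
  "egf c x = (\<Sum>m. c m / fact m * x ^ m)"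

definition egf_entire :: "(nat \<Rightarrow> real) \<Rightarrow> bool" where
  "egf_entire c \<longleftrightarrow> (\<forall>x. summable (\<lambda>m. c m / fact m * x ^ m))"

lemma egf_entireD: "egf_entire c \<Longrightarrow> summable (\<lambda>m. c m / fact m * x ^ m)"
  by (simp add: egf_entire_def)

lemma diffs_egf: "diffs (\<lambda>m. c m / fact m) = (\<lambda>m. c (Suc m) / fact m :: real)"
  by (rule ext) (simp add: diffs_def field_simps del: of_nat_Suc)

lemma egf_entire_shift: "egf_entire c \<Longrightarrow> egf_entire (\<lambda>m. c (m + k))"
proof (induction k)
  case (Suc k)
  then show ?case
    using termdiff_converges_all[of "\<lambda>m. c (m + k) / fact m"]
    by (simp add: egf_entire_def diffs_egf)
qed simp

lemma egf_entire_dominated: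
  assumes M_entire: "egf_entire M" and bound: "\<And>m. \<bar>c m\<bar> \<le> M m"
  shows "egf_entire c"
  unfolding egf_entire_def
proof
  fix x
  show "summable (\<lambda>m. c m / fact m * x ^ m)"
  proof (rule summable_comparison_test')
    show "norm (c m / fact m * x ^ m) \<le> M m / fact m * \<bar>x\<bar> ^ m" if "0 \<le> m" for m
      using bound[of m] by (auto simp: abs_mult power_abs intro!: mult_right_mono divide_right_mono)
  qed (rule egf_entireD[OF M_entire])
qed

lemma has_real_derivative_egf:
  assumes "egf_entire c"
  shows "(egf c has_real_derivative egf (\<lambda>m. c (Suc m)) x) (at x)"
  using termdiffs_strong_converges_everywhere[of "\<lambda>m. c m / fact m" x] assms
  by (simp add: egf_def[abs_def] egf_entire_def diffs_egf)

lemma egf_add: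
  assumes "egf_entire c" "egf_entire c'"
  shows "egf (\<lambda>m. c m + c' m) x = egf c x + egf c' x"
  using suminf_add[OF egf_entireD[OF assms(1), of x] egf_entireD[OF assms(2), of x]]
  by (simp add: egf_def add_divide_distrib distrib_right)

lemma egf_entire_add:
  assumes "egf_entire c" "egf_entire c'"
  shows "egf_entire (\<lambda>m. c m + c' m)"
  using summable_add[OF egf_entireD[OF assms(1)] egf_entireD[OF assms(2)]]
  by (simp add: egf_entire_def add_divide_distrib distrib_right)

lemma egf_uniform_limit:
  assumes M_entire: "egf_entire M" and a_bound: "\<And>m p. \<bar>a m p\<bar> \<le> M m"
    and g_bound: "\<And>p. p \<in> S \<Longrightarrow> \<bar>g p\<bar> \<le> X"
  shows "uniform_limit S (\<lambda>n p. \<Sum>m<n. a m p / fact m * g p ^ m) (\<lambda>p. egf (\<lambda>m. a m p) (g p)) sequentially"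
  unfolding egf_def
proof (rule Weierstrass_m_test)
  show "summable (\<lambda>m. M m / fact m * X ^ m)"
    by (rule egf_entireD[OF M_entire])
  show "norm (a m p / fact m * g p ^ m) \<le> M m / fact m * X ^ m" if "p \<in> S" for m p
  proof -
    have "0 \<le> M m" using a_bound[of m undefined] by linarith
    then show ?thesis
      unfolding norm_mult norm_power norm_divide using g_bound[OF that]
      by (intro mult_mono divide_mono power_mono) (auto simp: a_bound)
  qed
qed

lemma continuous_on_egf:
  fixes a :: "nat \<Rightarrow> real \<Rightarrow> real"
  assumes M_entire: "egf_entire M" and a_bound: "\<And>m t. \<bar>a m t\<bar> \<le> M m"
    and cont: "\<And>m. continuous_on UNIV (a m)"
  shows "continuous_on UNIV (\<lambda>p. egf (\<lambda>m. a m (fst p)) (snd p))"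
proof -
  have "isCont (\<lambda>p. egf (\<lambda>m. a m (fst p)) (snd p)) q" for q :: "real \<times> real"
  proof -
    define S where "S = {p :: real \<times> real. \<bar>snd p\<bar> < \<bar>snd q\<bar> + 1}"
    have "open S"
      unfolding S_def by (intro open_Collect_less continuous_intros)
    moreover have "continuous_on S (\<lambda>p. egf (\<lambda>m. a m (fst p)) (snd p))"
    proof (rule uniform_limit_theorem)
      show "uniform_limit S (\<lambda>n p. \<Sum>m<n. a m (fst p) / fact m * snd p ^ m)
          (\<lambda>p. egf (\<lambda>m. a m (fst p)) (snd p)) sequentially"
        by (rule egf_uniform_limit[OF M_entire a_bound, where X = "\<bar>snd q\<bar> + 1"]) (auto simp: S_def)
      have "continuous_on S (\<lambda>p. a m (fst p))" for m
        by (rule continuous_on_compose2[OF cont]) (auto intro!: continuous_on_fst)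
      then show
        "\<forall>\<^sub>F n in sequentially. continuous_on S (\<lambda>p. \<Sum>m<n. a m (fst p) / fact m * snd p ^ m)"
        by (intro always_eventually allI continuous_intros) auto
    qed simp
    moreover have "q \<in> S"
      by (simp add: S_def)
    ultimately show ?thesis
      by (simp add: continuous_on_eq_continuous_at)
  qed
  then show ?thesis
    by (simp add: continuous_on_eq_continuous_at)
qed

lemma has_real_derivative_egf_coefficients:
  fixes a a' :: "nat \<Rightarrow> real \<Rightarrow> real"
  assumes M: "egf_entire M" "\<And>m t. \<bar>a m t\<bar> \<le> M m" and M': "egf_entire M'" "\<And>m t. \<bar>a' m t\<bar> \<le> M' m"
    and deriv: "\<And>m t. (a m has_real_derivative a' m t) (at t)"
  shows "((\<lambda>t. egf (\<lambda>m. a m t) x) has_real_derivative egf (\<lambda>m. a' m t) x) (at t)"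
  unfolding egf_def
proof (rule has_field_derivative_series'(2)[where S = "UNIV :: real set" and ?x0.0 = 0])
  show "((\<lambda>t. a m t / fact m * x ^ m)
      has_real_derivative a' m t / fact m * x ^ m) (at t within UNIV)" for m t
    using deriv[of m t] by (intro DERIV_cmult_right DERIV_cdivide) simp
  show "uniformly_convergent_on UNIV (\<lambda>n t. \<Sum>m<n. a' m t / fact m * x ^ m)"
    using egf_uniform_limit[where a = a' and g = "\<lambda>_. x", OF M' order_refl]
    unfolding uniformly_convergent_on_def by blast
  show "summable (\<lambda>m. a m 0 / fact m * x ^ m)"
    by (rule egf_entireD[OF egf_entire_dominated[OF M]])
qed auto

lemma smooth_family_egf:
  fixes a :: "nat \<Rightarrow> nat \<Rightarrow> real \<Rightarrow> real"
  assumes deriv: "\<And>i m t. (a i m has_real_derivative a (Suc i) m t) (at t)"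
    and M: "\<And>i. egf_entire (M i)" "\<And>i m t. \<bar>a i m t\<bar> \<le> M i m"
  shows "smooth_family (\<lambda>i j p. egf (\<lambda>m. a i (m + j) (fst p)) (snd p))"
  unfolding smooth_family_def
proof (intro allI conjI)
  fix i j t x
  note M_shift = egf_entire_shift[OF M(1)]
  have "continuous_on UNIV (a i m)" for i m
    by (rule DERIV_continuous_on[OF has_field_derivative_at_within[OF deriv]])
  then show "continuous_on UNIV (\<lambda>p. egf (\<lambda>m. a i (m + j) (fst p)) (snd p))"
    by (rule continuous_on_egf[OF M_shift M(2)])
  show "((\<lambda>s. egf (\<lambda>m. a i (m + j) (fst (s, x))) (snd (s, x)))
      has_real_derivative egf (\<lambda>m. a (Suc i) (m + j) (fst (t, x))) (snd (t, x))) (at t)"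
    using has_real_derivative_egf_coefficients[OF M_shift M(2) M_shift M(2) deriv] by simp
  have "egf_entire (\<lambda>m. a i (m + j) t)"
    by (rule egf_entire_dominated[OF M_shift M(2)])
  from has_real_derivative_egf[OF this, of x]
  show "((\<lambda>y. egf (\<lambda>m. a i (m + j) (fst (t, y))) (snd (t, y)))
      has_real_derivative egf (\<lambda>m. a i (m + Suc j) (fst (t, x))) (snd (t, x))) (at x)"
    by simp
qed

lemma egf_eq_Taylor:
  assumes deriv: "\<And>m x. (w m has_real_derivative w (Suc m) x) (at x)"
    and M: "egf_entire M" "\<And>m y. \<bar>y\<bar> \<le> r \<Longrightarrow> \<bar>w m y\<bar> \<le> M m" and x_le: "\<bar>x\<bar> \<le> r"
  shows "egf (\<lambda>m. w m 0) x = w 0 x"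
proof -
  let ?P = "\<lambda>n. \<Sum>m<n. w m 0 / fact m * x ^ m"
  have "(\<lambda>n. ?P n - w 0 x) \<longlonglongrightarrow> 0"
  proof (rule Lim_null_comparison)
    show "(\<lambda>n. M n / fact n * \<bar>x\<bar> ^ n) \<longlonglongrightarrow> 0"
      by (rule summable_LIMSEQ_zero[OF egf_entireD[OF M(1)]])
    have "norm (?P n - w 0 x) \<le> M n / fact n * \<bar>x\<bar> ^ n" for n
    proof -
      obtain y where y_le: "\<bar>y\<bar> \<le> \<bar>x\<bar>" and remainder: "w 0 x = ?P n + w n y / fact n * x ^ n"
        using Maclaurin_all_le[of w "w 0" x n] deriv by auto
      have "\<bar>w n y\<bar> \<le> M n"
        using M(2) y_le x_le by force
      then show ?thesis
        unfolding remainder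
        by (auto simp: abs_mult power_abs intro!: mult_right_mono divide_right_mono)
    qed
    then show "\<forall>\<^sub>F n in sequentially. norm (?P n - w 0 x) \<le> M n / fact n * \<bar>x\<bar> ^ n"
      by (intro always_eventually allI)
  qed
  then have "(\<lambda>m. w m 0 / fact m * x ^ m) sums w 0 x"
    unfolding sums_def by (rule LIM_zero_cancel)
  then show ?thesis
    unfolding egf_def by (rule sums_unique[symmetric])
qed

lemma fact_mult_fact_le: "fact a * fact b \<le> (fact (a + b) :: real)"
proof -
  have "fact a * fact b \<le> (fact (a + b) :: nat)"
    by (intro dvd_imp_le fact_fact_dvd_fact) simp
  then have "real (fact a * fact b) \<le> real (fact (a + b))"
    by (simp only: of_nat_le_iff)
  then show ?thesis by simp
qed

lemma fact_power_mult_fact_le: "fact q ^ s * fact m \<le> (fact (s * q + m) :: real)"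
proof (induction s)
  case (Suc s)
  have "fact q ^ Suc s * fact m \<le> (fact q * fact (s * q + m) :: real)"
    using Suc by (simp add: mult.assoc)
  also have "\<dots> \<le> fact (q + (s * q + m))"
    by (rule fact_mult_fact_le)
  finally show ?case by (simp add: add.assoc)
qed simp

lemma fact_div_power_le:
  fixes y :: real
  assumes "s < n" "1 \<le> y"
  shows "fact (j div n) ^ s * y ^ j \<le> fact j * exp (y ^ n)"
proof -
  define q where "q = j div n"
  define r where "r = j mod n"
  define m where "m = (n - s) * q + r"
  have "j = n * q + r"
    by (simp add: q_def r_def)
  then have j_eq: "j = s * q + m"
    using assms(1) by (simp add: m_def flip: add_mult_distrib add.assoc)
  have "q + r \<le> m"
    using assms(1) by (simp add: m_def Suc_le_eq)
  then have "n * q + n * r \<le> n * m"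
    by (metis distrib_left mult_le_mono2)
  moreover have "r \<le> n * r"
    using assms(1) by (cases n) auto
  ultimately have "j \<le> n * m"
    using \<open>j = n * q + r\<close> by linarith
  have "fact q ^ s * y ^ j \<le> fact q ^ s * (y ^ n) ^ m"
    using assms(2) \<open>j \<le> n * m\<close> by (simp add: power_increasing flip: power_mult)
  also have "\<dots> \<le> fact q ^ s * (fact m * exp (y ^ n))"
    using assms(2) by (intro mult_left_mono power_le_fact_mult_exp) auto
  also have "\<dots> \<le> fact j * exp (y ^ n)"
    using fact_power_mult_fact_le[of q s m] by (simp add: j_eq flip: mult.assoc)
  finally show ?thesis
    by (simp add: q_def)
qed

lemma egf_entire_gevrey:
  assumes "s < n"
  shows "egf_entire (\<lambda>j. C * R ^ j * fact (j div n) ^ s)"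
  unfolding egf_entire_def
proof
  fix x :: real
  define y where "y = 2 * \<bar>R * x\<bar> + 1"
  show "summable (\<lambda>j. C * R ^ j * fact (j div n) ^ s / fact j * x ^ j)"
  proof (rule summable_comparison_test')
    show "summable (\<lambda>j. \<bar>C\<bar> * exp (y ^ n) * (1 / 2) ^ j)"
      by (intro summable_mult summable_geometric) auto
    fix j
    have "norm (C * R ^ j * fact (j div n) ^ s / fact j * x ^ j)
        = \<bar>C\<bar> * (fact (j div n) ^ s * (2 * \<bar>R * x\<bar>) ^ j / fact j) * (1 / 2) ^ j"
      by (simp add: abs_mult power_abs power_mult_distrib power_divide)
    also have "\<dots> \<le> \<bar>C\<bar> * (fact (j div n) ^ s * y ^ j / fact j) * (1 / 2) ^ j"
      by (intro mult_right_mono mult_left_mono divide_right_mono power_mono) (auto simp: y_def)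
    also have "\<dots> \<le> \<bar>C\<bar> * exp (y ^ n) * (1 / 2) ^ j"
      using fact_div_power_le[OF assms, of y j]
      by (intro mult_right_mono mult_left_mono) (auto simp: y_def field_simps)
    finally show
      "norm (C * R ^ j * fact (j div n) ^ s / fact j * x ^ j) \<le> \<bar>C\<bar> * exp (y ^ n) * (1 / 2) ^ j" .
  qed
qed

section \<open>Entire extension of classical solutions\<close>

definition kawahara_family :: "(real \<times> real) set \<Rightarrow> (nat \<Rightarrow> nat \<Rightarrow> real \<times> real \<Rightarrow> real) \<Rightarrow> bool" where
  "kawahara_family S W \<longleftrightarrow> smooth_family W \<and>
     (\<forall>p\<in>S. \<forall>i j. W i (j + 5) p = W (Suc i) j p + W i (j + 1) p + W i (j + 3) p)"

lemma add_power3_le_power5: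
  assumes "2 \<le> (R::real)"
  shows "R + R + R ^ 3 \<le> R ^ 5"
proof -
  have "2\<^sup>2 \<le> R\<^sup>2"
    using assms by (intro power_mono) auto
  then have "R * 4 \<le> R * R\<^sup>2" "R ^ 3 * 4 \<le> R ^ 3 * R\<^sup>2"
    using assms by (intro mult_left_mono; simp)+
  moreover have "0 \<le> R ^ 3"
    using assms by simp
  ultimately show ?thesis
    by (simp add: eval_nat_numeral)
qed

lemma kawahara_recurrence_bound:
  fixes w :: "nat \<Rightarrow> nat \<Rightarrow> real"
  assumes recurrence: "\<And>i j. w i (j + 5) = w (Suc i) j + w i (j + 1) + w i (j + 3)"
    and R_ge_2: "2 \<le> R" and C_nonneg: "0 \<le> C"
    and init: "\<And>i j. j < 5 \<Longrightarrow> \<bar>w i j\<bar> \<le> C * R ^ (i + j) * fact i ^ s"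
  shows "\<bar>w i j\<bar> \<le> C * R ^ (i + j) * fact (i + j div 5) ^ s"
proof (induction j arbitrary: i rule: less_induct)
  case (less j)
  show ?case
  proof (cases "j < 5")
    case True
    then show ?thesis using init[OF True] by simp
  next
    case False
    then obtain k where j_eq: "j = k + 5"
      by (metis add.commute le_Suc_ex not_less)
    define F where "F = C * R ^ (i + k) * fact (Suc (i + k div 5)) ^ s"
    have F_nonneg: "0 \<le> F" using R_ge_2 C_nonneg by (simp add: F_def)
    have lower_order: "\<bar>w i (k + l)\<bar> \<le> R ^ l * F" if "l < 5" for l
    proof -
      have "\<bar>w i (k + l)\<bar> \<le> C * R ^ (i + (k + l)) * fact (i + (k + l) div 5) ^ s"
        using less.IH[of "k + l" i] j_eq that by simp
      also have "\<dots> \<le> C * R ^ (i + (k + l)) * fact (Suc (i + k div 5)) ^ s"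
        using that R_ge_2 C_nonneg by (intro mult_left_mono power_mono fact_mono) auto
      also have "\<dots> = R ^ l * F"
        by (simp add: F_def power_add mult_ac)
      finally show ?thesis .
    qed
    have "\<bar>w (Suc i) k\<bar> \<le> R * F"
      using less.IH[of k "Suc i"] by (simp add: j_eq F_def mult_ac)
    moreover have "\<bar>w i (k + 1)\<bar> \<le> R * F" "\<bar>w i (k + 3)\<bar> \<le> R ^ 3 * F"
      using lower_order[of 1] lower_order[of 3] by simp_all
    ultimately have "\<bar>w i j\<bar> \<le> (R + R + R ^ 3) * F"
      using recurrence[of i k] unfolding j_eq distrib_right by linarith
    also have "\<dots> \<le> R ^ 5 * F"
      by (rule mult_right_mono[OF add_power3_le_power5[OF R_ge_2] F_nonneg])
    also have "\<dots> = C * R ^ (i + j) * fact (i + j div 5) ^ s"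
      by (simp add: j_eq F_def power_add mult_ac)
    finally show ?thesis .
  qed
qed

lemma kawahara_family_gevrey_bound:
  assumes W: "kawahara_family S W" "gevrey s W"
  obtains C R where "0 \<le> C" "1 \<le> R"
    "\<And>i j p. p \<in> S \<Longrightarrow> \<bar>W i j p\<bar> \<le> C * R ^ (i + j) * fact (i + j div 5) ^ s"
proof -
  obtain C R where C_nonneg: "0 \<le> C" and R_ge_2: "2 \<le> R"
    and bound: "\<And>i j p. \<bar>W i j p\<bar> \<le> C * R ^ (i + j) * (fact i * fact j) ^ s"
    using gevreyE[OF W(2)] by metis
  have "\<bar>W i j p\<bar> \<le> C * fact 5 ^ s * R ^ (i + j) * fact (i + j div 5) ^ s"
    if p_in: "p \<in> S" for i j p
  proof (rule kawahara_recurrence_bound[where w = "\<lambda>i j. W i j p"])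
    show "W i (j + 5) p = W (Suc i) j p + W i (j + 1) p + W i (j + 3) p" for i j
      using W(1) p_in by (simp add: kawahara_family_def)
    fix i j :: nat assume "j < 5"
    then have "(fact i * fact j) ^ s \<le> ((fact i * fact 5) ^ s :: real)"
      by (intro power_mono mult_left_mono fact_mono) auto
    then have "C * R ^ (i + j) * (fact i * fact j) ^ s \<le> C * R ^ (i + j) * (fact i * fact 5) ^ s"
      using C_nonneg R_ge_2 by (intro mult_left_mono) auto
    then show "\<bar>W i j p\<bar> \<le> C * fact 5 ^ s * R ^ (i + j) * fact i ^ s"
      using bound[of i j p] by (simp add: power_mult_distrib mult_ac)
  qed (use C_nonneg R_ge_2 in auto)
  then show thesis
    using C_nonneg R_ge_2 by (intro that[of "C * fact 5 ^ s" R]) auto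
qed

lemma kawahara_family_majorant:
  assumes W: "kawahara_family S W" "gevrey s W" and s_less: "s < 5"
  obtains M where "egf_entire M" "\<And>i j p. p \<in> S \<Longrightarrow> \<bar>W i j p\<bar> \<le> M (j + 5 * i)"
proof -
  obtain C R where C_nonneg: "0 \<le> C" and R_ge_1: "1 \<le> R"
    and bound: "\<And>i j p. p \<in> S \<Longrightarrow> \<bar>W i j p\<bar> \<le> C * R ^ (i + j) * fact (i + j div 5) ^ s"
    using kawahara_family_gevrey_bound[OF W] by auto
  show thesis
  proof
    show "egf_entire (\<lambda>k. C * R ^ k * fact (k div 5) ^ s)"
      by (rule egf_entire_gevrey[OF s_less])
    fix i j p assume "p \<in> S"
    have "C * R ^ (i + j) * fact (i + j div 5) ^ s \<le> C * R ^ (j + 5 * i) * fact (i + j div 5) ^ s"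
      using C_nonneg R_ge_1 by (intro mult_right_mono mult_left_mono power_increasing) auto
    then show "\<bar>W i j p\<bar> \<le> C * R ^ (j + 5 * i) * fact ((j + 5 * i) div 5) ^ s"
      using bound[OF \<open>p \<in> S\<close>, of i j] by (simp add: add.commute)
  qed
qed

definition taylor_extension ::
    "(nat \<Rightarrow> nat \<Rightarrow> real \<times> real \<Rightarrow> real) \<Rightarrow> nat \<Rightarrow> nat \<Rightarrow> real \<times> real \<Rightarrow> real" where
  "taylor_extension W i j p = egf (\<lambda>m. W i (m + j) (fst p, 0)) (snd p)"

lemma kawahara_family_taylor_extension:
  assumes W: "kawahara_family {p. snd p = 0} W"
    and M: "egf_entire M" "\<And>i j t. \<bar>W i j (t, 0)\<bar> \<le> M (j + 5 * i)"
  shows "kawahara_family UNIV (taylor_extension W)"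
  unfolding kawahara_family_def
proof (intro conjI ballI allI)
  have "((\<lambda>t. W i j (t, 0)) has_real_derivative W (Suc i) j (t, 0)) (at t)" for i j t
    using W by (auto simp: kawahara_family_def smooth_family_def)
  then show "smooth_family (taylor_extension W)"
    unfolding taylor_extension_def
    by (rule smooth_family_egf[where a = "\<lambda>i m t. W i m (t, 0)",
        OF _ egf_entire_shift[OF M(1)] M(2)])
  fix p :: "real \<times> real" and i j
  let ?c = "\<lambda>i j m. W i (m + j) (fst p, 0)"
  have "egf_entire (?c i j)" for i j
    by (rule egf_entire_shift[OF egf_entire_dominated[OF egf_entire_shift[OF M(1)] M(2)]])
  moreover have "?c i (j + 5) = (\<lambda>m. ?c (Suc i) j m + ?c i (j + 1) m + ?c i (j + 3) m)"
  proof
    show "?c i (j + 5) m = ?c (Suc i) j m + ?c i (j + 1) m + ?c i (j + 3) m" for m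
      using W[unfolded kawahara_family_def, THEN conjunct2, rule_format, of "(fst p, 0)" i "m + j"]
      by (simp add: add.assoc)
  qed
  ultimately show "taylor_extension W i (j + 5) p
      = taylor_extension W (Suc i) j p + taylor_extension W i (j + 1) p
        + taylor_extension W i (j + 3) p"
    unfolding taylor_extension_def by (simp only: egf_add egf_entire_add)
qed

lemma kawahara_extension:
  assumes W: "kawahara_family {p. \<bar>snd p\<bar> \<le> r} W" "gevrey s W" and s_less: "s < 5"
    and r_nonneg: "0 \<le> r"
  obtains V where "kawahara_family UNIV V"
    "\<And>p. \<bar>snd p\<bar> \<le> r \<Longrightarrow> V 0 0 p = W 0 0 p"
    "\<And>t x. (\<And>j. W 0 j (t, 0) = 0) \<Longrightarrow> V 0 0 (t, x) = 0"
proof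
  obtain M where M: "egf_entire M" "\<And>i j p. \<bar>snd p\<bar> \<le> r \<Longrightarrow> \<bar>W i j p\<bar> \<le> M (j + 5 * i)"
    using kawahara_family_majorant[OF W s_less] by auto
  show "kawahara_family UNIV (taylor_extension W)"
  proof (rule kawahara_family_taylor_extension[OF _ M(1)])
    show "kawahara_family {p. snd p = 0} W"
      using W(1) r_nonneg by (auto simp: kawahara_family_def)
  qed (use M(2) r_nonneg in simp)
  have der_x: "((\<lambda>x. W i j (t, x)) has_real_derivative W i (Suc j) (t, x)) (at x)" for i j t x
    using W(1) by (auto simp: kawahara_family_def smooth_family_def)
  show "taylor_extension W 0 0 p = W 0 0 p" if "\<bar>snd p\<bar> \<le> r" for p
    using egf_eq_Taylor[where w = "\<lambda>m x. W 0 m (fst p, x)", OF der_x M(1) _ that] M(2)[of _ 0]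
    by (simp add: taylor_extension_def)
  show "taylor_extension W 0 0 (t, x) = 0" if "\<And>j. W 0 j (t, 0) = 0" for t x
    using that by (simp add: taylor_extension_def egf_def)
qed

section \<open>Classical solutions are weak solutions\<close>

definition kawahara_adjoint :: "(nat \<Rightarrow> nat \<Rightarrow> real \<times> real \<Rightarrow> real) \<Rightarrow> real \<times> real \<Rightarrow> real" where
  "kawahara_adjoint D p = - D 1 0 p - D 0 1 p - D 0 3 p + D 0 5 p"

lemma kawahara_sol_iff:
  "kawahara_sol \<Omega> u \<longleftrightarrow>
     (\<forall>D. test_fun \<Omega> D \<longrightarrow> set_lebesgue_integral lebesgue \<Omega> (\<lambda>p. u p * kawahara_adjoint D p) = 0)"
  by (simp add: kawahara_sol_def kawahara_adjoint_def)

lemma borel_measurable_kawahara_adjoint: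
  assumes "smooth_family D"
  shows "kawahara_adjoint D \<in> borel_measurable borel"
  unfolding kawahara_adjoint_def
  by (intro borel_measurable_add borel_measurable_diff borel_measurable_uminus
      borel_measurable_smooth_family assms)

lemma set_lebesgue_integral_lebesgue_eq_lborel:
  fixes h :: "'a::euclidean_space \<Rightarrow> real"
  assumes "h \<in> borel_measurable borel" "\<And>p. p \<notin> \<Omega> \<Longrightarrow> h p = 0"
  shows "set_lebesgue_integral lebesgue \<Omega> h = (\<integral>p. h p \<partial>lborel)"
proof -
  have "(\<lambda>p. indicator \<Omega> p *\<^sub>R h p) = h"
    using assms(2) by (auto simp: fun_eq_iff indicator_def)
  then show ?thesis
    using assms(1) by (simp add: set_lebesgue_integral_def integral_completion)
qed

lemma test_fun_support:
  assumes "test_fun \<Omega> D"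
  obtains S where "compact S" "S \<subseteq> \<Omega>" "\<And>i j p. p \<notin> S \<Longrightarrow> D i j p = 0"
proof
  let ?S = "closure {p. D 0 0 p \<noteq> 0}"
  show "compact ?S" "?S \<subseteq> \<Omega>"
    using assms by (auto simp: test_fun_def)
  have "smooth_family D" "open (- ?S)"
    using assms by (auto simp: test_fun_def)
  moreover have "D 0 0 p = 0" if "p \<in> - ?S" for p
    using that closure_subset[of "{p. D 0 0 p \<noteq> 0}"] by auto
  ultimately show "D i j p = 0" if "p \<notin> ?S" for i j p
    using smooth_family_eq_0_on_open[of D "- ?S"] that by blast
qed

lemma kawahara_family_imp_kawahara_sol:
  assumes "kawahara_family UNIV V"
  shows "kawahara_sol \<Omega> (V 0 0)"
  unfolding kawahara_sol_iff
proof (intro allI impI)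
  have V_smooth: "smooth_family V"
    and V_eq: "V 0 (0 + 5) p = V (Suc 0) 0 p + V 0 (0 + 1) p + V 0 (0 + 3) p" for p
    using assms unfolding kawahara_family_def by blast+
  fix D assume "test_fun \<Omega> D"
  then obtain S where support: "compact S" "S \<subseteq> \<Omega>" and outside: "\<And>i j p. p \<notin> S \<Longrightarrow> D i j p = 0"
    and D_smooth: "smooth_family D"
    using test_fun_support by (metis test_fun_def)
  note by_parts = integral_smooth_family_by_parts[OF V_smooth D_smooth support(1) outside]
  have integrable: "integrable lborel (\<lambda>p. V a b p * D i j p)" for a b i j
    by (rule integrable_continuous_compact_support[OF _ support(1)])
       (auto simp: outside intro!: continuous_on_mult smooth_familyD(1)[OF V_smooth]
         smooth_familyD(1)[OF D_smooth])
  have "set_lebesgue_integral lebesgue \<Omega> (\<lambda>p. V 0 0 p * kawahara_adjoint D p)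
      = (\<integral>p. V 0 0 p * kawahara_adjoint D p \<partial>lborel)"
  proof (rule set_lebesgue_integral_lebesgue_eq_lborel)
    show "(\<lambda>p. V 0 0 p * kawahara_adjoint D p) \<in> borel_measurable borel"
      by (intro borel_measurable_times borel_measurable_smooth_family[OF V_smooth]
        borel_measurable_kawahara_adjoint[OF D_smooth])
    show "V 0 0 p * kawahara_adjoint D p = 0" if "p \<notin> \<Omega>" for p
    proof -
      have "p \<notin> S"
        using that support(2) by blast
      then show ?thesis
        by (simp add: kawahara_adjoint_def outside)
    qed
  qed
  also have "\<dots> = (\<integral>p. - (V 0 0 p * D 1 0 p) - V 0 0 p * D 0 1 p - V 0 0 p * D 0 3 p
      + V 0 0 p * D 0 5 p \<partial>lborel)"
    by (simp add: kawahara_adjoint_def algebra_simps)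
  also have "\<dots> = (\<integral>p. V 1 0 p * D 0 0 p \<partial>lborel) + (\<integral>p. V 0 1 p * D 0 0 p \<partial>lborel)
      + (\<integral>p. V 0 3 p * D 0 0 p \<partial>lborel) - (\<integral>p. V 0 5 p * D 0 0 p \<partial>lborel)"
    using by_parts[of 1 0] by_parts[of 0 1] by_parts[of 0 3] by_parts[of 0 5]
    by (simp add: integrable)
  also have "\<dots> = (\<integral>p. V 1 0 p * D 0 0 p + V 0 1 p * D 0 0 p + V 0 3 p * D 0 0 p
      - V 0 5 p * D 0 0 p \<partial>lborel)"
    by (simp add: integrable)
  also have "\<dots> = 0"
    by (simp add: V_eq[simplified] algebra_simps)
  finally show "set_lebesgue_integral lebesgue \<Omega> (\<lambda>p. V 0 0 p * kawahara_adjoint D p) = 0" .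
qed

section \<open>Mollified weak solutions are classical\<close>

lemma smooth_family_mollifier_eq_0:
  assumes K: "smooth_family K" "mollifier d (K 0 0)" and p_far: "d < norm p"
  shows "K i j p = 0"
proof (rule smooth_family_eq_0_on_open[OF K(1), of "- cball 0 d"])
  show "K 0 0 p = 0" if "p \<in> - cball 0 d" for p
    using that mollifierD(3)[OF K(2), of p] by simp
qed (use p_far in auto)

lemma test_fun_reflect_mollifier:
  assumes K: "smooth_family K" "mollifier d (K 0 0)" and cball_subset: "cball z d \<subseteq> \<Omega>"
  shows "test_fun \<Omega> (\<lambda>a b p. (-1) ^ (a + b) * K (i + a) (j + b) (z - p))"
    (is "test_fun \<Omega> ?D")
proof -
  have support: "{p. ?D 0 0 p \<noteq> 0} \<subseteq> cball z d"
  proof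
    fix p assume "p \<in> {p. ?D 0 0 p \<noteq> 0}"
    then have "\<not> d < norm (z - p)"
      using smooth_family_mollifier_eq_0[OF K, of "z - p" i j] by auto
    then show "p \<in> cball z d"
      by (simp add: dist_norm)
  qed
  have "compact (closure {p. ?D 0 0 p \<noteq> 0})"
    using bounded_subset[OF bounded_cball support] by (simp only: compact_closure)
  moreover have "closure {p. ?D 0 0 p \<noteq> 0} \<subseteq> \<Omega>"
    using closure_minimal[OF support closed_cball] cball_subset by (rule order_trans)
  ultimately show ?thesis
    unfolding test_fun_def using smooth_family_reflect[OF K(1)] by blast
qed

lemma kawahara_convolve:
  assumes f: "integrable lborel f" "\<And>p. p \<notin> \<Omega> \<Longrightarrow> f p = 0" and sol: "kawahara_sol \<Omega> f"
    and K: "smooth_family K" "mollifier d (K 0 0)" "\<And>i j. bounded (range (K i j))"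
    and cball_subset: "cball z d \<subseteq> \<Omega>"
  shows "convolve f (K i (j + 5)) z
    = convolve f (K (Suc i) j) z + convolve f (K i (j + 1)) z + convolve f (K i (j + 3)) z"
proof -
  define D where "D = (\<lambda>a b p. (-1) ^ (a + b) * K (i + a) (j + b) (z - p))"
  have D_test_fun: "test_fun \<Omega> D"
    unfolding D_def by (rule test_fun_reflect_mollifier[OF K(1,2) cball_subset])
  then have D_smooth: "smooth_family D"
    by (simp add: test_fun_def)
  have integrable: "integrable lborel (\<lambda>p. f p * K a b (z - p))" for a b
    by (rule integrable_convolve[OF f(1) borel_measurable_smooth_family[OF K(1)] K(3)])
  have "0 = set_lebesgue_integral lebesgue \<Omega> (\<lambda>p. f p * kawahara_adjoint D p)"
    using sol D_test_fun by (simp add: kawahara_sol_iff)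
  also have "\<dots> = (\<integral>p. f p * kawahara_adjoint D p \<partial>lborel)"
    using f borel_measurable_kawahara_adjoint[OF D_smooth]
    by (intro set_lebesgue_integral_lebesgue_eq_lborel) auto
  also have "\<dots> = (\<integral>p. f p * K (Suc i) j (z - p) + f p * K i (j + 1) (z - p)
      + f p * K i (j + 3) (z - p) - f p * K i (j + 5) (z - p) \<partial>lborel)"
    by (simp add: kawahara_adjoint_def D_def algebra_simps)
  also have "\<dots> = convolve f (K (Suc i) j) z + convolve f (K i (j + 1)) z
      + convolve f (K i (j + 3)) z - convolve f (K i (j + 5)) z"
    unfolding convolve_def by (simp add: integrable)
  finally show ?thesis
    by simp
qed

lemma abs_fst_le_norm: "\<bar>fst p\<bar> \<le> norm p" and abs_snd_le_norm: "\<bar>snd p\<bar> \<le> norm p"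
  for p :: "real \<times> real"
  using norm_fst_le[of "fst p" "snd p"] norm_snd_le[of "snd p" "fst p"] by simp_all

lemma convolve_mollifier_time_support:
  assumes f_support: "\<And>p. fst p \<notin> {t1..t2} \<Longrightarrow> f p = 0"
    and K: "smooth_family K" "mollifier d (K 0 0)" and z_outside: "fst z \<notin> {t1 - d..t2 + d}"
  shows "convolve f (K i j) z = 0"
proof (rule convolve_eq_0)
  fix p assume "f p \<noteq> 0"
  then have "fst p \<in> {t1..t2}"
    using f_support by blast
  then have "d < \<bar>fst (z - p)\<bar>"
    using z_outside unfolding atLeastAtMost_iff fst_diff by linarith
  also have "\<dots> \<le> norm (z - p)"
    by (rule abs_fst_le_norm)
  finally show "K i j (z - p) = 0"
    by (rule smooth_family_mollifier_eq_0[OF K])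
qed

lemma kawahara_family_convolve:
  assumes f: "integrable lborel f" "\<And>p. p \<notin> {t1..t2} \<times> {- a<..<a} \<Longrightarrow> f p = 0"
    and sol: "kawahara_sol (strip T a) f"
    and K: "smooth_family K" "mollifier d (K 0 0)" "\<And>i j. bounded (range (K i j))"
    and widths: "0 < d" "2 * d < t1" "2 * d < T - t2" "r + d < a"
  shows "kawahara_family {p. \<bar>snd p\<bar> \<le> r} (\<lambda>i j. convolve f (K i j))"
  unfolding kawahara_family_def
proof (intro conjI ballI allI)
  show "smooth_family (\<lambda>i j. convolve f (K i j))"
    by (rule smooth_family_convolve[OF f(1) K(1,3)])
  fix z :: "real \<times> real" and i j assume z_in: "z \<in> {p. \<bar>snd p\<bar> \<le> r}"
  show "convolve f (K i (j + 5)) z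
    = convolve f (K (Suc i) j) z + convolve f (K i (j + 1)) z + convolve f (K i (j + 3)) z"
  proof (cases "fst z \<in> {t1 - d..t2 + d}")
    case True
    have "cball z d \<subseteq> strip T a"
    proof
      fix p assume "p \<in> cball z d"
      then have "\<bar>fst p - fst z\<bar> \<le> d" "\<bar>snd p - snd z\<bar> \<le> d"
        using abs_fst_le_norm[of "p - z"] abs_snd_le_norm[of "p - z"]
        by (auto simp: dist_norm norm_minus_commute)
      then show "p \<in> strip T a"
        using True z_in widths by (auto simp: strip_def abs_le_iff)
    qed
    moreover have "f p = 0" if "p \<notin> strip T a" for p
      using that widths by (intro f(2)) (auto simp: strip_def)
    ultimately show ?thesis
      by (intro kawahara_convolve[OF f(1) _ sol K])
  next
    case False
    have "f p = 0" if "fst p \<notin> {t1..t2}" for p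
      using that by (intro f(2)) auto
    from convolve_mollifier_time_support[OF this K(1,2) False] show ?thesis
      by simp
  qed
qed

section \<open>Borel representatives\<close>

lemma L2_on_borel_representative:
  assumes L2: "L2_on \<Omega> u" and supp: "supp_in \<Omega> u S"
    and \<Omega>: "\<Omega> \<in> sets borel" and S: "S \<in> sets borel" "S \<subseteq> \<Omega>"
  obtains f where "f \<in> borel_measurable borel" "\<And>p. p \<notin> S \<Longrightarrow> f p = 0"
    "AE p in lebesgue. p \<in> \<Omega> \<longrightarrow> u p = f p" "integrable lborel (\<lambda>p. (f p)\<^sup>2)"
proof -
  have \<Omega>_lebesgue: "\<Omega> \<inter> space lebesgue \<in> sets lebesgue"
    using \<Omega> by simp
  have u: "u \<in> borel_measurable (lebesgue_on \<Omega>)"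
    "integrable lebesgue (\<lambda>p. indicator \<Omega> p *\<^sub>R (u p)\<^sup>2)"
    using L2 by (auto simp: L2_on_def set_integrable_def)
  have "(\<lambda>p. indicator \<Omega> p *\<^sub>R u p) \<in> borel_measurable lebesgue"
    using u(1) by (simp add: borel_measurable_restrict_space_iff[OF \<Omega>_lebesgue])
  then obtain g where g_representative: "g \<in> borel_measurable lborel"
    "AE p in lborel. indicator \<Omega> p *\<^sub>R u p = g p"
    using completion_ex_borel_measurable_real by blast
  define f where "f = (\<lambda>p. indicator S p * g p)"
  have [measurable]: "g \<in> borel_measurable borel" "S \<in> sets borel"
    using g_representative(1) S(1) by auto
  have f_measurable: "f \<in> borel_measurable borel"
    unfolding f_def by measurable
  have "AE p in lebesgue. p \<in> \<Omega> \<longrightarrow> p \<notin> S \<longrightarrow> u p = 0"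
    using supp \<Omega>_lebesgue unfolding supp_in_def by (simp add: AE_restrict_space_iff)
  with AE_completion[OF g_representative(2)] 
  have ae: "AE p in lebesgue. indicator \<Omega> p *\<^sub>R u p = f p"
    by eventually_elim (use S(2) in \<open>auto simp: f_def indicator_def split: if_splits\<close>)
  have "integrable lebesgue (\<lambda>p. (f p)\<^sup>2)"
  proof (rule integrable_cong_AE_imp[OF u(2)])
    show "(\<lambda>p. (f p)\<^sup>2) \<in> borel_measurable lebesgue"
      using f_measurable by (intro measurable_completion) simp
    show "AE p in lebesgue. indicator \<Omega> p *\<^sub>R (u p)\<^sup>2 = (f p)\<^sup>2"
      using ae by eventually_elim (auto simp: indicator_def split: if_splits)
  qed
  then have f_square: "integrable lborel (\<lambda>p. (f p)\<^sup>2)"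
    using f_measurable by (simp add: integrable_completion)
  show thesis
  proof (rule that[OF f_measurable _ _ f_square])
    show "AE p in lebesgue. p \<in> \<Omega> \<longrightarrow> u p = f p"
      using ae by eventually_elim auto
  qed (simp add: f_def)
qed

lemma integrable_of_square_integrable:
  fixes f :: "'a \<Rightarrow> real"
  assumes f: "f \<in> borel_measurable M" "integrable M (\<lambda>p. (f p)\<^sup>2)"
    and S: "S \<in> sets M" "emeasure M S < \<infinity>" "\<And>p. p \<notin> S \<Longrightarrow> f p = 0"
  shows "integrable M f"
proof (rule Bochner_Integration.integrable_bound)
  show "integrable M (\<lambda>p. indicator S p + (f p)\<^sup>2)"
    using f(2) S by (intro Bochner_Integration.integrable_add integrable_real_indicator)
  have "\<bar>f p\<bar> \<le> indicator S p + (f p)\<^sup>2" for p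
    using zero_le_power2[of "\<bar>f p\<bar> - 1 / 2"] S(3)[of p]
    by (cases "p \<in> S") (auto simp: power2_eq_square algebra_simps)
  then show "AE p in M. norm (f p) \<le> norm (indicator S p + (f p)\<^sup>2)"
    by simp
qed (rule f(1))

lemma kawahara_sol_cong_AE:
  assumes sol: "kawahara_sol \<Omega> u" and \<Omega>: "\<Omega> \<in> sets borel"
    and u: "u \<in> borel_measurable (lebesgue_on \<Omega>)" and f: "f \<in> borel_measurable borel"
    and ae: "AE p in lebesgue. p \<in> \<Omega> \<longrightarrow> u p = f p"
  shows "kawahara_sol \<Omega> f"
  unfolding kawahara_sol_iff
proof (intro allI impI)
  fix D assume D_test_fun: "test_fun \<Omega> D"
  let ?E = "kawahara_adjoint D"
  have [measurable]: "?E \<in> borel_measurable borel"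
    using D_test_fun by (intro borel_measurable_kawahara_adjoint) (simp add: test_fun_def)
  note [measurable] = f \<Omega>
  have "set_lebesgue_integral lebesgue \<Omega> (\<lambda>p. f p * ?E p)
      = set_lebesgue_integral lebesgue \<Omega> (\<lambda>p. u p * ?E p)"
    unfolding set_lebesgue_integral_def
  proof (rule integral_cong_AE)
    show "(\<lambda>p. indicator \<Omega> p *\<^sub>R (f p * ?E p)) \<in> borel_measurable lebesgue"
      by (intro measurable_completion) simp
    have "(\<lambda>p. indicator \<Omega> p *\<^sub>R u p) \<in> borel_measurable lebesgue"
      using u \<Omega> by (subst borel_measurable_restrict_space_iff[symmetric]) auto
    moreover have "?E \<in> borel_measurable lebesgue"
      by (intro measurable_completion) simp
    ultimately have "(\<lambda>p. (indicator \<Omega> p *\<^sub>R u p) * ?E p) \<in> borel_measurable lebesgue"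
      by (rule borel_measurable_times)
    then show "(\<lambda>p. indicator \<Omega> p *\<^sub>R (u p * ?E p)) \<in> borel_measurable lebesgue"
      by (simp add: mult.assoc)
    show "AE p in lebesgue. indicator \<Omega> p *\<^sub>R (f p * ?E p) = indicator \<Omega> p *\<^sub>R (u p * ?E p)"
      using ae by eventually_elim (auto simp: indicator_def)
  qed
  then show "set_lebesgue_integral lebesgue \<Omega> (\<lambda>p. f p * ?E p) = 0"
    using sol D_test_fun by (simp add: kawahara_sol_iff)
qed

lemma L2_norm_on_less:
  assumes ae: "AE p in lebesgue. p \<in> S \<longrightarrow> g p = h p"
    and small: "0 < e" "(\<integral>\<^sup>+p. ennreal ((h p)\<^sup>2) \<partial>lborel) < ennreal (e\<^sup>2)"
  shows "L2_norm_on S g < e"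
proof -
  define I where "I = set_lebesgue_integral lebesgue S (\<lambda>p. (g p)\<^sup>2)"
  have "I < e\<^sup>2"
  proof (cases "integrable lebesgue (\<lambda>p. indicator S p *\<^sub>R (g p)\<^sup>2)")
    case True
    then have "ennreal I = (\<integral>\<^sup>+p. ennreal (indicator S p *\<^sub>R (g p)\<^sup>2) \<partial>lebesgue)"
      by (simp add: I_def set_lebesgue_integral_def nn_integral_eq_integral)
    also have "\<dots> \<le> (\<integral>\<^sup>+p. ennreal ((h p)\<^sup>2) \<partial>lebesgue)"
      using ae by (intro nn_integral_mono_AE) (auto elim!: eventually_mono simp: indicator_def)
    also have "\<dots> < ennreal (e\<^sup>2)"
      using small(2) by (simp add: nn_integral_completion)
    finally show ?thesis
      using small(1) by (simp add: ennreal_less_iff I_def set_lebesgue_integral_def)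
  qed (use small(1) in \<open>simp add: I_def set_lebesgue_integral_def not_integrable_integral_eq\<close>)
  then show ?thesis
    using small(1) real_sqrt_less_mono by (fastforce simp: L2_norm_on_def I_def)
qed

section \<open>Approximation by entire solutions\<close>

lemma open_strip: "open (strip T a)"
  unfolding strip_def by (intro open_Collect_conj open_Collect_less continuous_intros)

lemma L2_on_strip_continuous:
  assumes v_continuous: "continuous_on UNIV v"
  shows "L2_on (strip T a) v"
  unfolding L2_on_def
proof
  show "v \<in> borel_measurable (lebesgue_on (strip T a))"
    using borel_measurable_continuous_onI[OF v_continuous]
    by (intro measurable_restrict_space1 measurable_completion) simp
  have "set_integrable lborel ({0..T} \<times> {- a..a}) (\<lambda>p. (v p)\<^sup>2)"
    unfolding set_integrable_def
    by (intro borel_integrable_compact compact_Times compact_Icc continuous_on_power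
      continuous_on_subset[OF v_continuous]) simp
  then have "set_integrable lborel (strip T a) (\<lambda>p. (v p)\<^sup>2)"
    by (rule set_integrable_subset)
       (auto simp: strip_def borel_open[OF open_strip, unfolded strip_def])
  then show "set_integrable lebesgue (strip T a) (\<lambda>p. (v p)\<^sup>2)"
    unfolding set_integrable_def by (subst integrable_completion) auto
qed

lemma kawahara_sol_borel_representative:
  assumes L2: "L2_on (strip T a) u" and sol: "kawahara_sol (strip T a) u"
    and supp: "supp_in (strip T a) u ({t1..t2} \<times> {- a<..<a})" and times: "0 < t1" "t2 < T"
  obtains f where "integrable lborel f" "integrable lborel (\<lambda>p. (f p)\<^sup>2)"
    "\<And>p. p \<notin> {t1..t2} \<times> {- a<..<a} \<Longrightarrow> f p = 0"
    "AE p in lebesgue. p \<in> strip T a \<longrightarrow> u p = f p" "kawahara_sol (strip T a) f"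
proof -
  let ?box = "{t1..t2} \<times> {- a<..<a}"
  have strip_borel: "strip T a \<in> sets borel"
    by (rule borel_open[OF open_strip])
  have box: "?box \<in> sets borel" "?box \<subseteq> strip T a"
    using times by (auto simp: strip_def borel_Times)
  obtain f where f_measurable: "f \<in> borel_measurable borel" and outside: "\<And>p. p \<notin> ?box \<Longrightarrow> f p = 0"
    and ae: "AE p in lebesgue. p \<in> strip T a \<longrightarrow> u p = f p"
    and f_square: "integrable lborel (\<lambda>p. (f p)\<^sup>2)"
    using L2_on_borel_representative[OF L2 supp strip_borel box] by blast
  have "emeasure lborel ?box < \<infinity>"
    by (intro emeasure_bounded_finite bounded_Times) auto
  then have f_integrable: "integrable lborel f"
    using f_measurable box
    by (intro integrable_of_square_integrable[OF _ f_square _ _ outside]) auto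
  have "kawahara_sol (strip T a) f"
    using kawahara_sol_cong_AE[OF sol strip_borel _ f_measurable ae] L2 by (simp add: L2_on_def)
  then show thesis
    using that[OF f_integrable f_square outside ae] by blast
qed

lemma kawahara_mollified_extension:
  assumes f: "integrable lborel f" "\<And>p. p \<notin> {t1..t2} \<times> {- a<..<a} \<Longrightarrow> f p = 0"
    and sol: "kawahara_sol (strip T a) f"
    and K: "smooth_family K" "mollifier d (K 0 0)" "gevrey s K" and s_less: "s < 5"
    and widths: "0 < d" "2 * d < t1" "2 * d < T - t2" "r + d < a" and r_nonneg: "0 \<le> r"
  obtains V where "kawahara_family UNIV V"
    "\<And>p. \<bar>snd p\<bar> \<le> r \<Longrightarrow> V 0 0 p = convolve f (K 0 0) p"
    "\<And>t x. t \<notin> {t1 - d..t2 + d} \<Longrightarrow> V 0 0 (t, x) = 0"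
proof -
  let ?W = "\<lambda>i j. convolve f (K i j)"
  have W: "kawahara_family {p. \<bar>snd p\<bar> \<le> r} ?W"
    by (rule kawahara_family_convolve[OF f sol K(1,2) gevrey_imp_bounded[OF K(3)] widths])
  have W_gevrey: "gevrey s ?W"
    by (rule gevrey_convolve[OF f(1) K(3) borel_measurable_smooth_family[OF K(1)]])
  obtain V where V: "kawahara_family UNIV V" "\<And>p. \<bar>snd p\<bar> \<le> r \<Longrightarrow> V 0 0 p = ?W 0 0 p"
    and V_eq_0: "\<And>t x. (\<And>j. ?W 0 j (t, 0) = 0) \<Longrightarrow> V 0 0 (t, x) = 0"
    using kawahara_extension[OF W W_gevrey s_less r_nonneg] by blast
  have f_time: "f p = 0" if "fst p \<notin> {t1..t2}" for p
    using that by (intro f(2)) auto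
  have "V 0 0 (t, x) = 0" if "t \<notin> {t1 - d..t2 + d}" for t x
  proof (rule V_eq_0)
    show "convolve f (K 0 j) (t, 0) = 0" for j
      by (rule convolve_mollifier_time_support[OF f_time K(1,2)]) (use that in simp_all)
  qed
  then show thesis
    using that[OF V] by blast
qed

lemma kawahara_entire_approximation:
  assumes L2: "L2_on (strip T a) u" and sol: "kawahara_sol (strip T a) u"
    and supp: "supp_in (strip T a) u ({t1..t2} \<times> {- a<..<a})"
    and times: "0 < t1" "t2 < T" and r_range: "0 \<le> r" "r < a" and e_pos: "0 < e"
  obtains V where "kawahara_family UNIV V" "\<And>t x. t \<notin> {t1 - e..t2 + e} \<Longrightarrow> V 0 0 (t, x) = 0"
    "L2_norm_on (strip T r) (\<lambda>p. V 0 0 p - u p) < e"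
proof -
  obtain f where f: "integrable lborel f" "integrable lborel (\<lambda>p. (f p)\<^sup>2)"
    and outside: "\<And>p. p \<notin> {t1..t2} \<times> {- a<..<a} \<Longrightarrow> f p = 0"
    and ae: "AE p in lebesgue. p \<in> strip T a \<longrightarrow> u p = f p" and sol_f: "kawahara_sol (strip T a) f"
    using kawahara_sol_borel_representative[OF L2 sol supp times] by blast
  have "0 < e\<^sup>2 / 2"
    using e_pos by simp
  then obtain \<delta> where \<delta>: "0 < \<delta>" and close: "\<And>d k. mollifier d k \<Longrightarrow> bounded (range k) \<Longrightarrow> d \<le> \<delta> \<Longrightarrow>
      L2_sqdist lborel (convolve f k) f \<le> ennreal (e\<^sup>2 / 2)"
    using L2_mollification[OF f] by blast
  define d where "d = min (min \<delta> e) (min (min t1 (T - t2)) (a - r)) / 3"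
  have "0 < d"
    using \<delta> e_pos times r_range by (simp add: d_def)
  moreover have "3 * d \<le> \<delta>" "3 * d \<le> e" "3 * d \<le> t1" "3 * d \<le> T - t2" "3 * d \<le> a - r"
    by (simp_all add: d_def min_def)
  ultimately have widths: "0 < d" "2 * d < t1" "2 * d < T - t2" "r + d < a" and "d \<le> \<delta>" "d \<le> e"
    by linarith+
  obtain K where K: "smooth_family K" "gevrey 2 K" "mollifier d (K 0 0)"
    using ex_gevrey_mollifier[OF widths(1)] by blast
  obtain V where V: "kawahara_family UNIV V" "\<And>p. \<bar>snd p\<bar> \<le> r \<Longrightarrow> V 0 0 p = convolve f (K 0 0) p"
    "\<And>t x. t \<notin> {t1 - d..t2 + d} \<Longrightarrow> V 0 0 (t, x) = 0"
    using kawahara_mollified_extension[OF f(1) outside sol_f K(1,3,2) _ widths r_range(1)] by auto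
  have "L2_norm_on (strip T r) (\<lambda>p. V 0 0 p - u p) < e"
  proof (rule L2_norm_on_less[OF _ e_pos])
    show "AE p in lebesgue. p \<in> strip T r \<longrightarrow> V 0 0 p - u p = convolve f (K 0 0) p - f p"
      using ae by eventually_elim (use r_range V(2) in \<open>auto simp: strip_def\<close>)
    have "L2_sqdist lborel (convolve f (K 0 0)) f \<le> ennreal (e\<^sup>2 / 2)"
      by (rule close[OF K(3) gevrey_imp_bounded[OF K(2)] \<open>d \<le> \<delta>\<close>])
    also have "\<dots> < ennreal (e\<^sup>2)"
      using e_pos by (intro ennreal_lessI) auto
    finally show "(\<integral>\<^sup>+p. ennreal ((convolve f (K 0 0) p - f p)\<^sup>2) \<partial>lborel) < ennreal (e\<^sup>2)"
      by (simp add: L2_sqdist_def)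
  qed
  moreover have "V 0 0 (t, x) = 0" if "t \<notin> {t1 - e..t2 + e}" for t x
    using that \<open>d \<le> e\<close> by (intro V(3)) auto
  ultimately show thesis
    using that V(1) by blast
qed

theorem theorem1p2:
  fixes n :: nat and t1 t2 T eps :: real and u :: "real \<times> real \<Rightarrow> real"
  assumes "n \<ge> 2"
    and "0 < t1" and "t1 < t2" and "t2 < T"
    and "L2_on (strip T (real n)) u"
    and "kawahara_sol (strip T (real n)) u"
    and "supp_in (strip T (real n)) u ({t1..t2} \<times> {- real n <..< real n})"
    and "0 < eps" and "eps < min t1 (T - t2)"
  shows "\<exists>v. L2_on (strip T (real n + 1)) v
           \<and> kawahara_sol (strip T (real n + 1)) v
           \<and> supp_in (strip T (real n + 1)) v ({t1 - eps .. t2 + eps} \<times> {- real n - 1 <..< real n + 1})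
           \<and> L2_norm_on (strip T (real n - 1)) (\<lambda>p. v p - u p) < eps"
proof -
  have "0 \<le> real n - 1" "real n - 1 < real n"
    using assms(1) by auto
  then obtain V where V: "kawahara_family UNIV V"
    and outside: "\<And>t x. t \<notin> {t1 - eps..t2 + eps} \<Longrightarrow> V 0 0 (t, x) = 0"
    and close: "L2_norm_on (strip T (real n - 1)) (\<lambda>p. V 0 0 p - u p) < eps"
    using kawahara_entire_approximation[OF assms(5-7,2,4) _ _ assms(8)] by blast
  show ?thesis
  proof (intro exI conjI)
    show "L2_on (strip T (real n + 1)) (V 0 0)"
      using V by (intro L2_on_strip_continuous smooth_familyD(1)) (simp add: kawahara_family_def)
    show "kawahara_sol (strip T (real n + 1)) (V 0 0)"
      by (rule kawahara_family_imp_kawahara_sol[OF V])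
    have "V 0 0 p = 0"
      if "p \<in> strip T (real n + 1)" "p \<notin> {t1 - eps..t2 + eps} \<times> {- real n - 1<..<real n + 1}" for p
      using that outside[of "fst p" "snd p"] by (cases p) (auto simp: strip_def)
    then show
      "supp_in (strip T (real n + 1)) (V 0 0) ({t1 - eps..t2 + eps} \<times> {- real n - 1<..<real n + 1})"
      unfolding supp_in_def by (intro AE_I2) auto
  qed (rule close)
qed

end
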